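(* Fix $m\ge1$ and $i_1,\dots,i_m\in\{1,\dots,n\}$, and put $\tilde F:=x_kx^k$, $\tilde Y:=x_k\gamma^k$. Then in $Z_n'$, \begin{align*} \widehat{x^{i_1}}\cdots\widehat{x^{i_m}}&=(H+1)\cdots(H+m)\,x^{i_1}\cdots x^{i_m}\\ &\quad+\sum_{q=1}^{m}\frac{\prod_{k=q+1}^{m}(H+k)}{2^q}\,\tilde F^{q-1}\Big(\tilde Y\sum_{t=0}^{q-1}[\eta^tx^{m-q-t}\gamma\,\partial^{q-1-t};i_1,\dots,i_m]+\tilde F\sum_{t=0}^{q}[\eta^tx^{m-q-t}\partial^{q-t};i_1,\dots,i_m]\Big)+I', \end{align*} i.e. the product of the classes $\widehat{x^{i_k}}$ equals the class modulo $I'$ of the displayed element of $\mathcal{A}'$.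
   Context: Fix $n\ge1$ and an invertible complex matrix $\eta=(\eta^{ij})$ with $\eta^{ij}=\eta^{ji}$ and inverse $(\eta_{ij})$. $\mathcal{A}=W(2n|n)$ is the associative superalgebra generated by even $x^1,\dots,x^n,\partial_1,\dots,\partial_n$ and odd $\gamma^1,\dots,\gamma^n$ with relations $x^ix^j=x^jx^i$, $\partial_i\partial_j=\partial_j\partial_i$, $\partial_ix^j-x^j\partial_i=\delta_i^j$, $\gamma^i$ commuting with all $x^j,\partial_j$, $\gamma^i\gamma^j+\gamma^j\gamma^i=2\eta^{ij}$. Repeated indices are summed; $x_i=\eta_{ij}x^j$, $\partial^i=\eta^{ij}\partial_j$. $X=\frac{\sqrt{-1}}{\sqrt2}\gamma^i\partial_i$, $H=-\frac12(\partial_ix^i+x^i\partial_i)$, $E=-\frac12\partial^i\partial_i$. $\mathcal{A}'$ is the localization of $\mathcal{A}$ at the multiplicative set generated by $\{H+k:k\in\mathbb{Z}\}$, $I'=\mathcal{A}'X+\mathcal{A}'E$, $N_{\mathcal{A}'}(I')=\{a\in\mathcal{A}':I'a\subset I'\}$, and $Z_n'=N_{\mathcal{A}'}(I')/I'$ (localized reduction algebra). For each $i$, $\widehat{x^i}\in Z_n'$ denotes the class modulo $I'$ of $(H+1)x^i+\frac12\gamma^jx_j\gamma^i+\frac12x^jx_j\partial^i$ (which lies in $N_{\mathcal{A}'}(I')$). Bracket symbol: for integers $a,q,t\ge0$ and $p$ with $2a+p+q+t=m$, $[\eta^ax^p\gamma^q\partial^t;i_1,\dots,i_m]:=0$ if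 $p<0$, and otherwise $:=\frac1{2^aa!p!t!}\sum_{\sigma\in S_m}\prod_{l=0}^{a-1}\eta^{i_{\sigma(2l+1)}i_{\sigma(2l+2)}}\,x^{i_{\sigma(2a+1)}}\cdots x^{i_{\sigma(2a+p)}}\,\gamma^{i_{\sigma(2a+p+1)}}\cdots\gamma^{i_{\sigma(2a+p+q)}}\,\partial^{i_{\sigma(2a+p+q+1)}}\cdots\partial^{i_{\sigma(m)}}$ (factors with exponent $0$ omitted). *)

theory Defs
  imports Complex_Main "HOL-Combinatorics.Permutations"
begin

text \<open>
  We avoid constructing W(2n|n) and its localization explicitly.  Instead we work in an
  arbitrary ring B (type variable 'b) containing complex scalars (central ring hom sc)
  and elements x i, d i (for the partial derivatives), g i (for the gammas), i < n,
  satisfying the defining relations of W(2n|n), and in which every H + k (k integer) is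
  invertible.  By the universal property of the localization, the image of A' in B is
  the subring Aloc generated by scalars, generators and the inverses of the H + k, and
  the image of I' is Aloc X + Aloc E.  Indices run over 0..n-1.
\<close>

definition metric :: "nat \<Rightarrow> (nat \<Rightarrow> nat \<Rightarrow> complex) \<Rightarrow> (nat \<Rightarrow> nat \<Rightarrow> complex) \<Rightarrow> bool" where
  "metric n eta etal \<longleftrightarrow>
     (\<forall>i<n. \<forall>j<n. eta i j = eta j i) \<and>
     (\<forall>i<n. \<forall>k<n. (\<Sum>j<n. eta i j * etal j k) = (if i = k then 1 else 0)) \<and>
     (\<forall>i<n. \<forall>k<n. (\<Sum>j<n. etal i j * eta j k) = (if i = k then 1 else 0))"

definition scalar_map :: "(complex \<Rightarrow> 'b::ring_1) \<Rightarrow> bool" where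
  "scalar_map sc \<longleftrightarrow>
     (\<forall>a b. sc (a + b) = sc a + sc b) \<and> (\<forall>a b. sc (a * b) = sc a * sc b) \<and>
     sc 1 = 1 \<and> (\<forall>c y. sc c * y = y * sc c)"

definition dup :: "nat \<Rightarrow> (nat \<Rightarrow> nat \<Rightarrow> complex) \<Rightarrow> (complex \<Rightarrow> 'b::ring_1) \<Rightarrow> (nat \<Rightarrow> 'b) \<Rightarrow> nat \<Rightarrow> 'b" where
  "dup n eta sc d i = (\<Sum>j<n. sc (eta i j) * d j)"

definition xlow :: "nat \<Rightarrow> (nat \<Rightarrow> nat \<Rightarrow> complex) \<Rightarrow> (complex \<Rightarrow> 'b::ring_1) \<Rightarrow> (nat \<Rightarrow> 'b) \<Rightarrow> nat \<Rightarrow> 'b" where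
  "xlow n etal sc x i = (\<Sum>j<n. sc (etal i j) * x j)"

definition Hop :: "nat \<Rightarrow> (complex \<Rightarrow> 'b::ring_1) \<Rightarrow> (nat \<Rightarrow> 'b) \<Rightarrow> (nat \<Rightarrow> 'b) \<Rightarrow> 'b" where
  "Hop n sc x d = sc (-1/2) * (\<Sum>i<n. d i * x i + x i * d i)"

definition Xop :: "nat \<Rightarrow> (complex \<Rightarrow> 'b::ring_1) \<Rightarrow> (nat \<Rightarrow> 'b) \<Rightarrow> (nat \<Rightarrow> 'b) \<Rightarrow> 'b" where
  "Xop n sc d g = sc (\<i> / complex_of_real (sqrt 2)) * (\<Sum>i<n. g i * d i)"

definition Eop :: "nat \<Rightarrow> (nat \<Rightarrow> nat \<Rightarrow> complex) \<Rightarrow> (complex \<Rightarrow> 'b::ring_1) \<Rightarrow> (nat \<Rightarrow> 'b) \<Rightarrow> 'b" where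
  "Eop n eta sc d = sc (-1/2) * (\<Sum>i<n. dup n eta sc d i * d i)"

definition WC_alg :: "nat \<Rightarrow> (nat \<Rightarrow> nat \<Rightarrow> complex) \<Rightarrow> (complex \<Rightarrow> 'b::ring_1) \<Rightarrow>
    (nat \<Rightarrow> 'b) \<Rightarrow> (nat \<Rightarrow> 'b) \<Rightarrow> (nat \<Rightarrow> 'b) \<Rightarrow> bool" where
  "WC_alg n eta sc x d g \<longleftrightarrow>
     scalar_map sc \<and>
     (\<forall>i<n. \<forall>j<n. x i * x j = x j * x i) \<and>
     (\<forall>i<n. \<forall>j<n. d i * d j = d j * d i) \<and>
     (\<forall>i<n. \<forall>j<n. d i * x j - x j * d i = (if i = j then 1 else 0)) \<and>
     (\<forall>i<n. \<forall>j<n. g i * x j = x j * g i) \<and>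
     (\<forall>i<n. \<forall>j<n. g i * d j = d j * g i) \<and>
     (\<forall>i<n. \<forall>j<n. g i * g j + g j * g i = sc (2 * eta i j)) \<and>
     (\<forall>k::int. \<exists>u. u * (Hop n sc x d + of_int k) = 1 \<and> (Hop n sc x d + of_int k) * u = 1)"

inductive_set Aloc :: "nat \<Rightarrow> (complex \<Rightarrow> 'b::ring_1) \<Rightarrow> (nat \<Rightarrow> 'b) \<Rightarrow> (nat \<Rightarrow> 'b) \<Rightarrow> (nat \<Rightarrow> 'b) \<Rightarrow> 'b set"
  for n sc x d g where
  scal: "sc c \<in> Aloc n sc x d g"
| genx: "i < n \<Longrightarrow> x i \<in> Aloc n sc x d g"
| gend: "i < n \<Longrightarrow> d i \<in> Aloc n sc x d g"
| geng: "i < n \<Longrightarrow> g i \<in> Aloc n sc x d g"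
| inv: "u * (Hop n sc x d + of_int k) = 1 \<Longrightarrow> (Hop n sc x d + of_int k) * u = 1 \<Longrightarrow> u \<in> Aloc n sc x d g"
| add: "a \<in> Aloc n sc x d g \<Longrightarrow> b \<in> Aloc n sc x d g \<Longrightarrow> a + b \<in> Aloc n sc x d g"
| mult: "a \<in> Aloc n sc x d g \<Longrightarrow> b \<in> Aloc n sc x d g \<Longrightarrow> a * b \<in> Aloc n sc x d g"

definition in_Iprime :: "nat \<Rightarrow> (nat \<Rightarrow> nat \<Rightarrow> complex) \<Rightarrow> (complex \<Rightarrow> 'b::ring_1) \<Rightarrow>
    (nat \<Rightarrow> 'b) \<Rightarrow> (nat \<Rightarrow> 'b) \<Rightarrow> (nat \<Rightarrow> 'b) \<Rightarrow> 'b \<Rightarrow> bool" where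
  "in_Iprime n eta sc x d g z \<longleftrightarrow>
     (\<exists>a\<in>Aloc n sc x d g. \<exists>b\<in>Aloc n sc x d g. z = a * Xop n sc d g + b * Eop n eta sc d)"

definition xhat :: "nat \<Rightarrow> (nat \<Rightarrow> nat \<Rightarrow> complex) \<Rightarrow> (nat \<Rightarrow> nat \<Rightarrow> complex) \<Rightarrow> (complex \<Rightarrow> 'b::ring_1) \<Rightarrow>
    (nat \<Rightarrow> 'b) \<Rightarrow> (nat \<Rightarrow> 'b) \<Rightarrow> (nat \<Rightarrow> 'b) \<Rightarrow> nat \<Rightarrow> 'b" where
  "xhat n eta etal sc x d g i =
     (Hop n sc x d + 1) * x i
     + sc (1/2) * (\<Sum>j<n. g j * xlow n etal sc x j * g i)
     + sc (1/2) * (\<Sum>j<n. x j * xlow n etal sc x j) * dup n eta sc d i"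

definition Ftil :: "nat \<Rightarrow> (nat \<Rightarrow> nat \<Rightarrow> complex) \<Rightarrow> (complex \<Rightarrow> 'b::ring_1) \<Rightarrow> (nat \<Rightarrow> 'b) \<Rightarrow> 'b" where
  "Ftil n etal sc x = (\<Sum>k<n. xlow n etal sc x k * x k)"

definition Ytil :: "nat \<Rightarrow> (nat \<Rightarrow> nat \<Rightarrow> complex) \<Rightarrow> (complex \<Rightarrow> 'b::ring_1) \<Rightarrow> (nat \<Rightarrow> 'b) \<Rightarrow> (nat \<Rightarrow> 'b) \<Rightarrow> 'b" where
  "Ytil n etal sc x g = (\<Sum>k<n. xlow n etal sc x k * g k)"

text \<open>Bracket symbol [eta^a x^p gamma^q partial^t; i_1,...,i_m], with m = length idx,
  positions 0-indexed (position 2l, 2l+1 carry the l-th eta factor, etc.).\<close>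
definition bracket :: "nat \<Rightarrow> (nat \<Rightarrow> nat \<Rightarrow> complex) \<Rightarrow> (complex \<Rightarrow> 'b::ring_1) \<Rightarrow>
    (nat \<Rightarrow> 'b) \<Rightarrow> (nat \<Rightarrow> 'b) \<Rightarrow> (nat \<Rightarrow> 'b) \<Rightarrow> nat \<Rightarrow> int \<Rightarrow> nat \<Rightarrow> nat \<Rightarrow> nat list \<Rightarrow> 'b" where
  "bracket n eta sc x d g a p q t idx =
     (if p < 0 then 0 else
      (let m = length idx; pp = nat p in
       sc (1 / (2 ^ a * fact a * fact pp * fact t)) *
       (\<Sum>\<sigma>\<in>{\<sigma>. \<sigma> permutes {..<m}}.
          sc (\<Prod>l<a. eta (idx ! \<sigma> (2*l)) (idx ! \<sigma> (2*l+1)))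
          * prod_list (map (\<lambda>j. x (idx ! \<sigma> j)) [2*a..<2*a+pp])
          * prod_list (map (\<lambda>j. g (idx ! \<sigma> j)) [2*a+pp..<2*a+pp+q])
          * prod_list (map (\<lambda>j. dup n eta sc d (idx ! \<sigma> j)) [2*a+pp+q..<m]))))"

end

theory Submission
  imports Defs "HOL-Combinatorics.Multiset_Permutations"
begin

text \<open>
  Put $Y = \tilde Y$ and $F = \tilde F = Y^2$. Then $\widehat{x^i} = (H+1)x^i + \frac12 Y\gamma^i
  + \frac12 F\partial^i$, and the two sides of the claim already agree in the algebra, before
  passing to the quotient; the left ideal plays no role. The reason is that
  $U_q = \sum_t [\eta^t x^{m-q-t}\partial^{q-t}]$ is the coefficient of $z^q$ in
  $\prod_k (x^{i_k} + z\partial^{i_k})$ (Wick's theorem), and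
  $V_q = \sum_t [\eta^t x^{m-q-t}\gamma\partial^{q-1-t}]$ arises likewise by replacing one factor
  by $z\gamma^{i_k}$, so adding a new index $i$ in front gives
  $U'_q = x^i U_q + \partial^i U_{q-1}$ and
  $V'_q = x^i V_q + \partial^i V_{q-1} + \gamma^i U_{q-1}$.
  Multiplying $F^{q-1}(Y V_q + F U_q)$ by $\widehat{x^i}$ from the left, and using
  $\gamma^i Y + Y\gamma^i = 2x^i$ and $\partial^i Y = Y\partial^i + \gamma^i$, reproduces exactly
  these recursions.

  The brackets are handled as iterated operators on functions of finite sets of positions: an
  operator $f \mapsto (A \mapsto \sum_{k \in A} u_k f(A - \{k\}))$ for each single factor and a similar
  one for $\eta$. On these, passing from $A$ to $A \cup \{i\}$ acts as a derivation.
\<close>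

subsection \<open>Operators on functions of finite sets\<close>

definition letter_op :: "('k \<Rightarrow> 'b::ring_1) \<Rightarrow> ('k set \<Rightarrow> 'b) \<Rightarrow> 'k set \<Rightarrow> 'b" where
  "letter_op u f A = (\<Sum>k\<in>A. u k * f (A - {k}))"

text \<open>The sum runs over ordered pairs of distinct positions, so a symmetric \<open>N\<close>
  counts each unordered pair twice. Iterating \<open>a\<close> times therefore produces the
  overcount \<open>2 ^ a * fact a\<close> that the bracket divides out.\<close>

definition pair_op :: "('k \<Rightarrow> 'k \<Rightarrow> 'b::ring_1) \<Rightarrow> ('k set \<Rightarrow> 'b) \<Rightarrow> 'k set \<Rightarrow> 'b" where
  "pair_op N f A = (\<Sum>k\<in>A. letter_op (N k) f (A - {k}))"

lemma letter_op_cong: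
  assumes "\<And>B. B \<subseteq> A \<Longrightarrow> f B = h B"
  shows "letter_op u f A = letter_op u h A"
  unfolding letter_op_def by (rule sum.cong) (auto simp: assms)

lemma pair_op_cong:
  assumes "\<And>B. B \<subseteq> A \<Longrightarrow> f B = h B"
  shows "pair_op N f A = pair_op N h A"
  unfolding pair_op_def by (intro sum.cong refl letter_op_cong assms) auto

text \<open>The insertion identities below hold only on subsets of a finite \<open>A\<close> that
  avoids \<open>i\<close>, so they are not equalities of functions. Both operators look at subsets
  of their argument only, which makes rewriting under iterates legitimate.\<close>

lemma funpow_cong_subset:
  fixes T :: "('k set \<Rightarrow> 'b) \<Rightarrow> 'k set \<Rightarrow> 'b"
  assumes cong: "\<And>f h A. (\<And>B. B \<subseteq> A \<Longrightarrow> f B = h B) \<Longrightarrow> T f A = T h A"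
    and eq: "\<And>B. B \<subseteq> A \<Longrightarrow> f B = h B"
  shows "(T ^^ p) f A = (T ^^ p) h A"
  using eq
proof (induction p arbitrary: A)
  case (Suc p)
  have "T ((T ^^ p) f) A = T ((T ^^ p) h) A"
    by (rule cong, rule Suc.IH) (use Suc.prems in blast)
  then show ?case by simp
qed simp

lemma letter_op_add: "letter_op u (\<lambda>A. f A + h A) A = letter_op u f A + letter_op u h A"
  by (simp add: letter_op_def distrib_left sum.distrib)

lemma pair_op_add: "pair_op N (\<lambda>A. f A + h A) A = pair_op N f A + pair_op N h A"
  by (simp add: pair_op_def letter_op_add sum.distrib)

lemma letter_op_diff: "letter_op u (\<lambda>A. f A - h A) A = letter_op u f A - letter_op u h A"
  by (simp add: letter_op_def right_diff_distrib sum_subtractf)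

lemma pair_op_diff: "pair_op N (\<lambda>A. f A - h A) A = pair_op N f A - pair_op N h A"
  by (simp add: pair_op_def letter_op_diff sum_subtractf)

lemma letter_op_mult_left:
  assumes "\<And>k. u k * c = c * u k"
  shows "letter_op u (\<lambda>A. c * f A) A = c * letter_op u f A"
  unfolding letter_op_def by (simp add: sum_distrib_left assms flip: mult.assoc)

lemma pair_op_mult_left:
  assumes "\<And>k l. N k l * c = c * N k l"
  shows "pair_op N (\<lambda>A. c * f A) A = c * pair_op N f A"
  unfolding pair_op_def by (simp add: letter_op_mult_left assms sum_distrib_left)

lemma letter_op_zero: "letter_op u (\<lambda>A. 0) A = 0"
  by (simp add: letter_op_def)

section \<open>Product rules for inserting a position\<close>

lemma letter_op_insert:
  assumes "finite A" "i \<notin> A"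
  shows "letter_op u f (insert i A) = u i * f A + letter_op u (\<lambda>B. f (insert i B)) A"
proof -
  have "insert i A - {k} = insert i (A - {k})" if "k \<in> A" for k
    using that assms by auto
  then show ?thesis
    using assms by (simp add: letter_op_def)
qed

lemma sum_swap_distinct:
  fixes h :: "'k \<Rightarrow> 'k \<Rightarrow> 'b::comm_monoid_add"
  assumes "finite A"
  shows "(\<Sum>k\<in>A. \<Sum>l\<in>A - {k}. h k l) = (\<Sum>l\<in>A. \<Sum>k\<in>A - {l}. h k l)"
proof -
  have "A - {k} = {l \<in> A. k \<noteq> l}" "A - {k} = {l \<in> A. l \<noteq> k}" for k by auto
  then show ?thesis
    using sum.swap_restrict[OF assms assms, of h "(\<noteq>)"] by simp
qed

text \<open>Both sides sum over ordered pairs of distinct positions, and removing \<open>k\<close>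
  then \<open>l\<close> leaves the same set as removing \<open>l\<close> then \<open>k\<close>. Only
  the coefficients have to be exchanged.\<close>

lemma letter_op_commute:
  assumes "\<And>k l. u k * v l = v l * u k"
  shows "letter_op u (letter_op v f) = letter_op v (letter_op u f)"
proof
  fix A
  show "letter_op u (letter_op v f) A = letter_op v (letter_op u f) A"
  proof (cases "finite A")
    case True
    have "letter_op u (letter_op v f) A = (\<Sum>k\<in>A. \<Sum>l\<in>A - {k}. u k * (v l * f (A - {k} - {l})))"
      by (simp add: letter_op_def sum_distrib_left)
    also have "\<dots> = (\<Sum>l\<in>A. \<Sum>k\<in>A - {l}. u k * (v l * f (A - {k} - {l})))"
      by (rule sum_swap_distinct) fact
    also have "\<dots> = (\<Sum>l\<in>A. \<Sum>k\<in>A - {l}. v l * (u k * f (A - {l} - {k})))"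
      by (simp add: assms Diff_insert2[symmetric] insert_commute flip: mult.assoc)
    finally show ?thesis by (simp add: letter_op_def sum_distrib_left)
  qed (simp add: letter_op_def)
qed

lemma pair_op_letter_op_commute:
  assumes "\<And>k l j. N k l * u j = u j * N k l"
  shows "pair_op N (letter_op u f) = letter_op u (pair_op N f)"
proof
  fix A
  show "pair_op N (letter_op u f) A = letter_op u (pair_op N f) A"
  proof (cases "finite A")
    case True
    have "pair_op N (letter_op u f) A = (\<Sum>k\<in>A. letter_op u (letter_op (N k) f) (A - {k}))"
      unfolding pair_op_def using letter_op_commute[of "N k" u for k] assms by metis
    also have "\<dots> = (\<Sum>k\<in>A. \<Sum>j\<in>A - {k}. u j * letter_op (N k) f (A - {k} - {j}))"
      by (simp add: letter_op_def)
    also have "\<dots> = (\<Sum>j\<in>A. \<Sum>k\<in>A - {j}. u j * letter_op (N k) f (A - {k} - {j}))"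
      by (rule sum_swap_distinct) fact
    also have "\<dots> = (\<Sum>j\<in>A. \<Sum>k\<in>A - {j}. u j * letter_op (N k) f (A - {j} - {k}))"
      by (simp add: Diff_insert2[symmetric] insert_commute)
    also have "\<dots> = letter_op u (pair_op N f) A"
      by (simp add: letter_op_def[of u] pair_op_def sum_distrib_left)
    finally show ?thesis .
  qed (simp add: letter_op_def pair_op_def)
qed

text \<open>Leibniz rule: the new position is consumed by one of the \<open>p\<close> copies or by
  none. Since the \<open>u k\<close> commute, \<open>u i\<close> can be brought to the front from
  each copy, and the \<open>p\<close> choices give the same term. For \<open>p = 0\<close> the
  truncated exponent \<open>p - 1\<close> is harmless because its coefficient is 0.\<close>

lemma letter_op_pow_insert:
  assumes "\<And>k l. u k * u l = u l * u k" "finite A" "i \<notin> A"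
  shows "(letter_op u ^^ p) f (insert i A) =
    of_nat p * (u i * (letter_op u ^^ (p - 1)) f A) + (letter_op u ^^ p) (\<lambda>B. f (insert i B)) A"
  using assms(2,3)
proof (induction p arbitrary: A)
  case (Suc p)
  let ?r = "\<lambda>B. of_nat p * (u i * (letter_op u ^^ (p - 1)) f B)"
  have "(letter_op u ^^ Suc p) f (insert i A) =
      u i * (letter_op u ^^ p) f A + letter_op u (\<lambda>B. (letter_op u ^^ p) f (insert i B)) A"
    using Suc.prems by (simp add: letter_op_insert)
  also have "letter_op u (\<lambda>B. (letter_op u ^^ p) f (insert i B)) A =
      letter_op u (\<lambda>B. ?r B + (letter_op u ^^ p) (\<lambda>B. f (insert i B)) B) A"
    by (rule letter_op_cong) (use Suc in \<open>blast intro: finite_subset\<close>)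
  also have "\<dots> = letter_op u ?r A + (letter_op u ^^ Suc p) (\<lambda>B. f (insert i B)) A"
    by (simp add: letter_op_add)
  also have "letter_op u ?r A = of_nat p * (u i * (letter_op u ^^ p) f A)"
    by (cases p)
      (simp_all add: letter_op_zero letter_op_mult_left assms(1) mult_of_nat_commute[symmetric]
        del: of_nat_Suc)
  finally show ?case by (simp add: algebra_simps)
qed simp

text \<open>The position \<open>i\<close> can be the first or the second member of a pair; by
  symmetry the two cases agree, whence the factor 2.\<close>

lemma pair_op_insert:
  assumes "finite A" "i \<notin> A" and sym: "\<And>k l. N k l = N l k"
  shows "pair_op N f (insert i A) =
    of_nat 2 * letter_op (N i) f A + pair_op N (\<lambda>B. f (insert i B)) A"
proof -
  have *: "insert i A - {k} = insert i (A - {k})" if "k \<in> A" for k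
    using that assms by auto
  have "pair_op N f (insert i A) = letter_op (N i) f A + (\<Sum>k\<in>A. letter_op (N k) f (insert i (A - {k})))"
    using assms by (simp add: pair_op_def *)
  also have "(\<Sum>k\<in>A. letter_op (N k) f (insert i (A - {k}))) =
      (\<Sum>k\<in>A. N k i * f (A - {k})) + pair_op N (\<lambda>B. f (insert i B)) A"
    using assms by (simp add: pair_op_def letter_op_insert sum.distrib)
  also have "(\<Sum>k\<in>A. N k i * f (A - {k})) = letter_op (N i) f A"
    by (simp add: letter_op_def sym[of _ i])
  finally show ?thesis by (simp add: mult_2)
qed

text \<open>The same Leibniz rule for pairings. Centrality of \<open>N\<close> lets
  \<open>letter_op (N i)\<close>, which records the partner of \<open>i\<close>, move out past the
  remaining pairings.\<close>

lemma pair_op_pow_insert: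
  assumes central: "\<And>k l y. N k l * y = y * N k l" and sym: "\<And>k l. N k l = N l k"
    and "finite A" "i \<notin> A"
  shows "(pair_op N ^^ a) f (insert i A) =
    of_nat (2 * a) * letter_op (N i) ((pair_op N ^^ (a - 1)) f) A
      + (pair_op N ^^ a) (\<lambda>B. f (insert i B)) A"
  using assms(3,4)
proof (induction a arbitrary: A)
  case (Suc a)
  let ?r = "\<lambda>B. of_nat (2 * a) * letter_op (N i) ((pair_op N ^^ (a - 1)) f) B"
  have "(pair_op N ^^ Suc a) f (insert i A) =
      of_nat 2 * letter_op (N i) ((pair_op N ^^ a) f) A
        + pair_op N (\<lambda>B. (pair_op N ^^ a) f (insert i B)) A"
    using Suc.prems pair_op_insert[OF _ _ sym] by simp
  also have "pair_op N (\<lambda>B. (pair_op N ^^ a) f (insert i B)) A =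
      pair_op N (\<lambda>B. ?r B + (pair_op N ^^ a) (\<lambda>B. f (insert i B)) B) A"
    by (rule pair_op_cong) (use Suc in \<open>blast intro: finite_subset\<close>)
  also have "\<dots> = pair_op N ?r A + (pair_op N ^^ Suc a) (\<lambda>B. f (insert i B)) A"
    by (simp add: pair_op_add)
  also have "pair_op N ?r A = of_nat (2 * a) * letter_op (N i) ((pair_op N ^^ a) f) A"
  proof (cases a)
    case (Suc b)
    have "pair_op N ?r A = of_nat (2 * a) * pair_op N (letter_op (N i) ((pair_op N ^^ (a - 1)) f)) A"
      by (rule pair_op_mult_left) (rule mult_of_nat_commute[symmetric])
    also have "pair_op N (letter_op (N i) ((pair_op N ^^ (a - 1)) f)) = letter_op (N i) (pair_op N ((pair_op N ^^ (a - 1)) f))"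
      by (rule pair_op_letter_op_commute) (rule central)
    finally show ?thesis using Suc by simp
  qed (simp add: letter_op_zero pair_op_def)
  finally show ?case by (simp add: algebra_simps mult_2)
qed simp

subsection \<open>The recursion for bracket sums\<close>

lemma funpow_add:
  fixes T :: "('k set \<Rightarrow> 'b::ring_1) \<Rightarrow> 'k set \<Rightarrow> 'b"
  assumes "\<And>f h A. T (\<lambda>A. f A + h A) A = T f A + T h A"
  shows "(T ^^ p) (\<lambda>A. f A + h A) A = (T ^^ p) f A + (T ^^ p) h A"
proof (induction p arbitrary: A)
  case (Suc p)
  then have "(T ^^ p) (\<lambda>A. f A + h A) = (\<lambda>A. (T ^^ p) f A + (T ^^ p) h A)" by blast
  then show ?case by (simp add: assms)
qed simp

lemma funpow_diff:
  fixes T :: "('k set \<Rightarrow> 'b::ring_1) \<Rightarrow> 'k set \<Rightarrow> 'b"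
  assumes "\<And>f h A. T (\<lambda>A. f A - h A) A = T f A - T h A"
  shows "(T ^^ p) (\<lambda>A. f A - h A) A = (T ^^ p) f A - (T ^^ p) h A"
proof (induction p arbitrary: A)
  case (Suc p)
  then have "(T ^^ p) (\<lambda>A. f A - h A) = (\<lambda>A. (T ^^ p) f A - (T ^^ p) h A)" by blast
  then show ?case by (simp add: assms)
qed simp

lemma funpow_mult_left:
  fixes T :: "('k set \<Rightarrow> 'b::ring_1) \<Rightarrow> 'k set \<Rightarrow> 'b"
  assumes "\<And>f A. T (\<lambda>A. c * f A) A = c * T f A"
  shows "(T ^^ p) (\<lambda>A. c * f A) A = c * (T ^^ p) f A"
proof (induction p arbitrary: A)
  case (Suc p)
  then have "(T ^^ p) (\<lambda>A. c * f A) = (\<lambda>A. c * (T ^^ p) f A)" by blast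
  then show ?case by (simp add: assms)
qed simp

lemma funpow_commute:
  assumes "\<And>f. op1 (op2 f) = op2 (op1 f)"
  shows "(op1 ^^ p) (op2 f) = op2 ((op1 ^^ p) f)"
  by (induction p) (simp_all add: assms)

section \<open>Central scalars and halving\<close>

locale central_scalars =
  fixes sc :: "complex \<Rightarrow> 'b::ring_1"
  assumes scalar: "scalar_map sc"
begin

lemma sc_add: "sc (a + b) = sc a + sc b"
  and sc_mult: "sc (a * b) = sc a * sc b"
  and sc_1 [simp]: "sc 1 = 1"
  and sc_comm: "sc c * y = y * sc c"
  using scalar unfolding scalar_map_def by blast+

lemma sc_left_comm: "y * (sc c * z) = sc c * (y * z)"
  by (metis mult.assoc sc_comm)

lemma sc_0 [simp]: "sc 0 = 0"
  using sc_add[of 0 0] by simp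

lemma sc_of_nat: "sc (of_nat k) = of_nat k"
  by (induction k) (simp_all add: sc_add)

lemma sc_sum: "sc (\<Sum>i\<in>A. f i) = (\<Sum>i\<in>A. sc (f i))"
  by (induction A rule: infinite_finite_induct) (simp_all add: sc_add)

lemma sc_2: "sc (2 * c) * y = sc c * y + sc c * y"
  by (simp only: mult_2 sc_add distrib_right)

lemma half_double: "sc (1/2) * y + sc (1/2) * y = y"
  by (simp flip: distrib_right sc_add)

lemma half: "sc (1/2) * (y + y) = y"
  by (simp only: distrib_left half_double)

lemma neg_half: "sc (-1/2) * (y + y) = - y"
proof -
  have "sc (-1/2) = - sc (1/2)"
    unfolding eq_neg_iff_add_eq_0 sc_add[symmetric] by simp
  then show ?thesis using half[of y] by simp
qed

end

text \<open>The type \<open>'k\<close> stands for positions in the index list, not for the indices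
  themselves: repeated indices are then still distinct elements of a set. \<open>N k l\<close> is
  the metric entry at the indices of the two positions.\<close>

locale normal_ordering = central_scalars sc
  for sc :: "complex \<Rightarrow> 'b::ring_1" +
  fixes N :: "'k \<Rightarrow> 'k \<Rightarrow> complex" and X D G :: "'k \<Rightarrow> 'b"
  assumes N_sym: "N k l = N l k"
    and X_comm: "X k * X l = X l * X k"
    and D_comm: "D k * D l = D l * D k"
    and D_X: "D k * X l = X l * D k + sc (N k l)"
    and G_X: "G k * X l = X l * G k"
    and G_D: "G k * D l = D l * G k"
begin

abbreviation "Nb \<equiv> \<lambda>k l. sc (N k l)"

text \<open>The bracket before normalisation. Starting from the indicator of the empty set forces
  every position to be consumed, so the value on \<open>A\<close> sums over all arrangements of
  \<open>A\<close> into \<open>a\<close> pairs, \<open>p\<close> letters X, \<open>q\<close> letters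
  G and \<open>t\<close> letters D.\<close>

definition ord_sum :: "nat \<Rightarrow> nat \<Rightarrow> nat \<Rightarrow> nat \<Rightarrow> 'k set \<Rightarrow> 'b" where
  "ord_sum a p q t = (pair_op Nb ^^ a) ((letter_op X ^^ p) ((letter_op G ^^ q) ((letter_op D ^^ t)
     (\<lambda>A. if A = {} then 1 else 0))))"

lemma letter_op_X_D: "letter_op X (\<lambda>A. D i * f A) A = D i * letter_op X f A - letter_op (Nb i) f A"
proof -
  have "X k * (D i * y) = D i * (X k * y) - sc (N i k) * y" for k y
    using D_X[of i k] by (simp add: algebra_simps flip: mult.assoc)
  then show ?thesis
    by (simp add: letter_op_def sum_distrib_left sum_subtractf)
qed

text \<open>Pulling \<open>D i\<close> to the left out of \<open>p\<close> letters X leaves one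
  contraction with each of them. The contractions are central scalars, so they commute with the
  other letters and the \<open>p\<close> terms coincide.\<close>

lemma pow_X_D:
  "(letter_op X ^^ p) (\<lambda>A. D i * f A) A =
    D i * (letter_op X ^^ p) f A - of_nat p * letter_op (Nb i) ((letter_op X ^^ (p - 1)) f) A"
proof (induction p arbitrary: A)
  case (Suc p)
  then have "(letter_op X ^^ p) (\<lambda>A. D i * f A) =
      (\<lambda>A. D i * (letter_op X ^^ p) f A - of_nat p * letter_op (Nb i) ((letter_op X ^^ (p - 1)) f) A)"
    by blast
  then have "(letter_op X ^^ Suc p) (\<lambda>A. D i * f A) A =
      letter_op X (\<lambda>A. D i * (letter_op X ^^ p) f A - of_nat p * letter_op (Nb i) ((letter_op X ^^ (p - 1)) f) A) A"
    by simp
  also have "\<dots> = D i * (letter_op X ^^ Suc p) f A - letter_op (Nb i) ((letter_op X ^^ p) f) A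
      - letter_op X (\<lambda>A. of_nat p * letter_op (Nb i) ((letter_op X ^^ (p - 1)) f) A) A"
    by (simp add: letter_op_diff letter_op_X_D)
  also have "letter_op X (\<lambda>A. of_nat p * letter_op (Nb i) ((letter_op X ^^ (p - 1)) f) A) A =
      of_nat p * letter_op X (letter_op (Nb i) ((letter_op X ^^ (p - 1)) f)) A"
    by (rule letter_op_mult_left) (rule mult_of_nat_commute[symmetric])
  also have "\<dots> = of_nat p * letter_op (Nb i) ((letter_op X ^^ p) f) A"
    by (cases p) (simp_all add: letter_op_commute[OF sc_comm[symmetric]])
  finally show ?case by (simp add: algebra_simps)
qed simp

text \<open>The new position lands in a pair, an X, a G or a D, and its letter is then brought to
  the front. Only D costs something, namely the contractions with the \<open>p\<close> letters X it
  crosses. The blocks are treated from the innermost outwards; with \<open>q \<le> 1\<close> no two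
  gammas ever have to be exchanged.\<close>

lemma ord_sum_insert:
  assumes A: "finite A" "i \<notin> A" and q: "q \<le> 1"
  shows "ord_sum a p q t (insert i A) =
      of_nat (2 * a) * letter_op (Nb i) (ord_sum (a - 1) p q t) A
      + of_nat p * (X i * ord_sum a (p - 1) q t A)
      + of_nat q * (G i * ord_sum a p (q - 1) t A)
      + of_nat t * (D i * ord_sum a p q (t - 1) A - of_nat p * letter_op (Nb i) (ord_sum a (p - 1) q (t - 1)) A)"
proof -
  define d where "d t = (letter_op D ^^ t) (\<lambda>A. if A = {} then 1 else 0)" for t
  define e where "e q t = (letter_op G ^^ q) (d t)" for q t
  define f where "f p q t = (letter_op X ^^ p) (e q t)" for p q t
  have ord_sum: "ord_sum a p q t = (pair_op Nb ^^ a) (f p q t)" for a p q t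
    by (simp add: ord_sum_def f_def e_def d_def)
  have fin: "finite B" "i \<notin> B" if "B \<subseteq> A" for B
    using that A finite_subset by blast+
  have nat_comm: "y * of_nat k = of_nat k * y" for k and y :: 'b
    by (rule mult_of_nat_commute[symmetric])
  have pair_op_mult: "pair_op Nb (\<lambda>A. c * h A) B = c * pair_op Nb h B" for c h B
    by (rule pair_op_mult_left) (rule sc_comm)
  have d_ins: "d t (insert i B) = of_nat t * (D i * d (t - 1) B)" if "B \<subseteq> A" for B
  proof -
    \<comment> \<open>The base function vanishes on every \<open>insert i B\<close>, so the terms in
      which no D consumes \<open>i\<close> drop out.\<close>
    have "(letter_op D ^^ t) (\<lambda>B. 0) C = 0" for C
      by (induction t arbitrary: C) (auto simp: letter_op_def)
    then show ?thesis
      unfolding d_def by (subst letter_op_pow_insert) (use fin[OF that] D_comm in auto)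
  qed
  have e_ins: "e q t (insert i B) = of_nat q * (G i * e (q - 1) t B) + of_nat t * (D i * e q (t - 1) B)"
    if B: "B \<subseteq> A" for B
  proof -
    have "e q t (insert i B) = of_nat q * (G i * e (q - 1) t B)
        + (letter_op G ^^ q) (\<lambda>B. d t (insert i B)) B"
      using q fin[OF B] by (cases q) (auto simp: e_def letter_op_insert)
    also have "(letter_op G ^^ q) (\<lambda>B. d t (insert i B)) B =
        (letter_op G ^^ q) (\<lambda>B. of_nat t * (D i * d (t - 1) B)) B"
      using B by (intro funpow_cong_subset letter_op_cong d_ins) auto
    also have "\<dots> = of_nat t * (D i * e q (t - 1) B)"
      by (simp add: funpow_mult_left letter_op_mult_left G_D nat_comm e_def)
    finally show ?thesis .
  qed
  have f_ins: "f p q t (insert i B) = of_nat p * (X i * f (p - 1) q t B)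
      + (of_nat q * (G i * f p (q - 1) t B)
      + of_nat t * (D i * f p q (t - 1) B - of_nat p * letter_op (Nb i) (f (p - 1) q (t - 1)) B))"
    if B: "B \<subseteq> A" for B
  proof -
    have "f p q t (insert i B) = of_nat p * (X i * f (p - 1) q t B)
        + (letter_op X ^^ p) (\<lambda>B. e q t (insert i B)) B"
      unfolding f_def by (rule letter_op_pow_insert) (use fin[OF B] X_comm in auto)
    also have "(letter_op X ^^ p) (\<lambda>B. e q t (insert i B)) B =
        (letter_op X ^^ p) (\<lambda>B. of_nat q * (G i * e (q - 1) t B) + of_nat t * (D i * e q (t - 1) B)) B"
      using B by (intro funpow_cong_subset letter_op_cong e_ins) auto
    also have "\<dots> = of_nat q * (G i * f p (q - 1) t B)
        + of_nat t * (D i * f p q (t - 1) B - of_nat p * letter_op (Nb i) (f (p - 1) q (t - 1)) B)"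
      by (simp add: funpow_add letter_op_add funpow_diff letter_op_diff funpow_mult_left
          letter_op_mult_left G_X nat_comm pow_X_D f_def)
    finally show ?thesis .
  qed
  have "ord_sum a p q t (insert i A) = of_nat (2 * a) * letter_op (Nb i) (ord_sum (a - 1) p q t) A
      + (pair_op Nb ^^ a) (\<lambda>B. f p q t (insert i B)) A"
    unfolding ord_sum by (rule pair_op_pow_insert[OF sc_comm arg_cong[OF N_sym] A])
  also have "(pair_op Nb ^^ a) (\<lambda>B. f p q t (insert i B)) A =
      (pair_op Nb ^^ a) (\<lambda>B. of_nat p * (X i * f (p - 1) q t B)
      + (of_nat q * (G i * f p (q - 1) t B)
      + of_nat t * (D i * f p q (t - 1) B - of_nat p * letter_op (Nb i) (f (p - 1) q (t - 1)) B))) A"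
    by (intro funpow_cong_subset pair_op_cong f_ins) auto
  also have "\<dots> = of_nat p * (X i * ord_sum a (p - 1) q t A)
      + (of_nat q * (G i * ord_sum a p (q - 1) t A)
      + of_nat t * (D i * ord_sum a p q (t - 1) A
          - of_nat p * (pair_op Nb ^^ a) (letter_op (Nb i) (f (p - 1) q (t - 1))) A))"
    unfolding ord_sum
    by (simp add: funpow_add pair_op_add funpow_diff pair_op_diff funpow_mult_left pair_op_mult)
  also have "(pair_op Nb ^^ a) (letter_op (Nb i) (f (p - 1) q (t - 1))) = letter_op (Nb i) (ord_sum a (p - 1) q (t - 1))"
    unfolding ord_sum by (intro funpow_commute pair_op_letter_op_commute sc_comm)
  finally show ?thesis by (simp add: algebra_simps)
qed

definition nbracket :: "nat \<Rightarrow> int \<Rightarrow> nat \<Rightarrow> nat \<Rightarrow> 'k set \<Rightarrow> 'b" where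
  "nbracket a p q t A =
    (if p < 0 then 0 else sc (1 / (2 ^ a * fact a * fact (nat p) * fact t)) * ord_sum a (nat p) q t A)"

text \<open>The multiplicities \<open>2 * a\<close>, \<open>p\<close> and \<open>t\<close> cancel
  against the factorials and the power of 2, lowering the corresponding parameter by one. The
  naturals \<open>a\<close> and \<open>t\<close> need a guard at 0, where subtraction truncates; for
  the integer \<open>p\<close> the value -1 gives 0 by definition.\<close>

lemma nbracket_insert:
  assumes A: "finite A" "i \<notin> A" and q: "q \<le> 1"
  shows "nbracket a p q t (insert i A) =
      (if a = 0 then 0 else letter_op (Nb i) (nbracket (a - 1) p q t) A)
      + X i * nbracket a (p - 1) q t A
      + of_nat q * (G i * nbracket a p (q - 1) t A)
      + (if t = 0 then 0 else D i * nbracket a p q (t - 1) A - letter_op (Nb i) (nbracket a (p - 1) q (t - 1)) A)"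
proof (cases "p < 0")
  case True
  then show ?thesis by (simp add: nbracket_def[abs_def] letter_op_zero)
next
  case False
  then obtain r where p: "p = int r" using nonneg_int_cases[of p] by auto
  define c where "c a p t = (1 / (2 ^ a * fact a * fact p * fact t) :: complex)" for a p t
  have nbracket: "nbracket a (int r) q t = (\<lambda>A. sc (c a r t) * ord_sum a r q t A)" for a r q t
    by (simp add: nbracket_def c_def fun_eq_iff)
  have c_a: "sc (c a r t) * of_nat (2 * a) = sc (c (a - 1) r t)" if "a \<noteq> 0" for r t
    using that unfolding sc_of_nat[symmetric] sc_mult[symmetric] c_def of_nat_mult
    by (cases a) (auto simp: field_simps simp del: of_nat_Suc)
  have c_p: "sc (c a r t) * of_nat r = sc (c a (r - 1) t)" if "r \<noteq> 0" for t
    using that unfolding sc_of_nat[symmetric] sc_mult[symmetric] c_def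
    by (cases r) (auto simp: field_simps simp del: of_nat_Suc)
  have c_t: "sc (c a r t) * of_nat t = sc (c a r (t - 1))" if "t \<noteq> 0" for r
    using that unfolding sc_of_nat[symmetric] sc_mult[symmetric] c_def
    by (cases t) (auto simp: field_simps simp del: of_nat_Suc)
  have letter_op_c: "letter_op (Nb i) (\<lambda>A. sc c * f A) A = sc c * letter_op (Nb i) f A" for c f A
    by (rule letter_op_mult_left) (rule sc_comm)
  have "nbracket a p q t (insert i A) = 
      (sc (c a r t) * of_nat (2 * a)) * letter_op (Nb i) (ord_sum (a - 1) r q t) A
      + (sc (c a r t) * of_nat r) * (X i * ord_sum a (r - 1) q t A)
      + of_nat q * (G i * (sc (c a r t) * ord_sum a r (q - 1) t A))
      + ((sc (c a r t) * of_nat t) * (D i * ord_sum a r q (t - 1) A)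
        - (sc (c a r t) * of_nat t) * of_nat r * letter_op (Nb i) (ord_sum a (r - 1) q (t - 1)) A)"
    unfolding p nbracket ord_sum_insert[OF assms]
    by (simp only: distrib_left right_diff_distrib mult.assoc
        sc_left_comm[of "of_nat q"] sc_left_comm[of "G i"])
  also have "(sc (c a r t) * of_nat (2 * a)) * letter_op (Nb i) (ord_sum (a - 1) r q t) A =
      (if a = 0 then 0 else letter_op (Nb i) (nbracket (a - 1) p q t) A)"
    by (simp add: p nbracket letter_op_c c_a del: of_nat_mult)
  also have "(sc (c a r t) * of_nat r) * (X i * ord_sum a (r - 1) q t A) = X i * nbracket a (p - 1) q t A"
  proof (cases r)
    case (Suc s)
    then have "p - 1 = int s" by (simp add: p)
    with Suc show ?thesis
      using c_p[of t] nbracket[of a s q t] by (simp add: sc_left_comm[of "X i"] del: of_nat_Suc)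
  qed (simp add: p nbracket_def)
  also have "G i * (sc (c a r t) * ord_sum a r (q - 1) t A) = G i * nbracket a p (q - 1) t A"
    by (simp add: p nbracket)
  also have "(sc (c a r t) * of_nat t) * (D i * ord_sum a r q (t - 1) A)
        - (sc (c a r t) * of_nat t) * of_nat r * letter_op (Nb i) (ord_sum a (r - 1) q (t - 1)) A
      = (if t = 0 then 0 else D i * nbracket a p q (t - 1) A - letter_op (Nb i) (nbracket a (p - 1) q (t - 1)) A)"
  proof (cases "t = 0")
    case t: False
    have "sc (c a r (t - 1)) * (D i * ord_sum a r q (t - 1) A) = D i * nbracket a p q (t - 1) A"
      unfolding p nbracket by (rule sc_left_comm[symmetric])
    moreover have "sc (c a r (t - 1)) * of_nat r * letter_op (Nb i) (ord_sum a (r - 1) q (t - 1)) A =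
        letter_op (Nb i) (nbracket a (p - 1) q (t - 1)) A"
    proof (cases r)
      case (Suc s)
      then have "p - 1 = int s" by (simp add: p)
      with Suc show ?thesis
        using c_p[of "t - 1"] nbracket[of a s q "t - 1"] by (simp add: letter_op_c del: of_nat_Suc)
    qed (simp add: p nbracket_def[abs_def] letter_op_zero)
    ultimately show ?thesis using t by (simp add: c_t)
  qed simp
  finally show ?thesis .
qed

text \<open>$U_q$ is \<open>bracket_sum 0 q (m - q)\<close> and $V_q$ is \<open>bracket_sum 1 (q - 1) (m - q)\<close>,
  with $m$ the number of positions.\<close>
definition bracket_sum :: "nat \<Rightarrow> nat \<Rightarrow> int \<Rightarrow> 'k set \<Rightarrow> 'b" where
  "bracket_sum q s c A = (\<Sum>t\<le>s. nbracket t (c - int t) q (s - t) A)"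

text \<open>Wick cancellation: the terms in which \<open>i\<close> joins a pair in summand
  \<open>t + 1\<close> equal the contractions subtracted when \<open>D i\<close> is moved to the
  front in summand \<open>t\<close>. After summing over \<open>t\<close> all contractions
  disappear.\<close>

lemma bracket_sum_insert:
  assumes A: "finite A" "i \<notin> A" and q: "q \<le> 1"
  shows "bracket_sum q s c (insert i A) = X i * bracket_sum q s (c - 1) A + of_nat q * (G i * bracket_sum (q - 1) s c A)
      + (if s = 0 then 0 else D i * bracket_sum q (s - 1) c A)"
proof -
  let ?L = "\<lambda>t. letter_op (Nb i) (nbracket t (c - int (Suc t)) q (s - Suc t)) A"
  let ?\<eta> = "\<lambda>t. if t = 0 then 0 else letter_op (Nb i) (nbracket (t - 1) (c - int t) q (s - t)) A"
  let ?D = "\<lambda>t. if s - t = 0 then 0 else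
    D i * nbracket t (c - int t) q (s - t - 1) A - letter_op (Nb i) (nbracket t (c - int t - 1) q (s - t - 1)) A"
  have split: "bracket_sum q s c (insert i A) = (\<Sum>t\<le>s. ?\<eta> t)
      + (\<Sum>t\<le>s. X i * nbracket t (c - int t - 1) q (s - t) A)
      + (\<Sum>t\<le>s. of_nat q * (G i * nbracket t (c - int t) (q - 1) (s - t) A)) + (\<Sum>t\<le>s. ?D t)"
    unfolding bracket_sum_def nbracket_insert[OF assms] sum.distrib by (rule refl)
  have X: "(\<Sum>t\<le>s. X i * nbracket t (c - int t - 1) q (s - t) A) = X i * bracket_sum q s (c - 1) A"
  proof -
    have "c - int t - 1 = c - 1 - int t" for t by simp
    then show ?thesis unfolding bracket_sum_def sum_distrib_left by (simp only:)
  qed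
  have G: "(\<Sum>t\<le>s. of_nat q * (G i * nbracket t (c - int t) (q - 1) (s - t) A)) =
      of_nat q * (G i * bracket_sum (q - 1) s c A)"
    unfolding bracket_sum_def sum_distrib_left ..
  \<comment> \<open>The pairing term is zero at \<open>t = 0\<close>; shifting \<open>t\<close> by
    one turns the others into \<open>?L\<close>. The derivative term in turn vanishes at
    \<open>t = s\<close>, so both sums range over \<open>t < s\<close> and cancel.\<close>
  have \<eta>: "(\<Sum>t\<le>s. ?\<eta> t) = (\<Sum>t<s. ?L t)"
    unfolding lessThan_Suc_atMost[symmetric] by (subst sum.lessThan_Suc_shift) simp
  have "(\<Sum>t\<le>s. ?D t) = (\<Sum>t<s. ?D t)"
    unfolding lessThan_Suc_atMost[symmetric] by simp
  also have "\<dots> = (\<Sum>t<s. D i * nbracket t (c - int t) q (s - 1 - t) A - ?L t)"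
  proof (intro sum.cong refl)
    fix t assume "t \<in> {..<s}"
    moreover have "c - int t - 1 = c - int (Suc t)" "s - t - 1 = s - Suc t" "s - 1 - t = s - Suc t"
      by simp_all
    ultimately show "?D t = D i * nbracket t (c - int t) q (s - 1 - t) A - ?L t"
      by (simp only: if_False not_True_eq_False lessThan_iff zero_less_diff neq0_conv not_gr_zero[symmetric] not_not)
  qed
  also have "\<dots> = (if s = 0 then 0 else D i * bracket_sum q (s - 1) c A) - (\<Sum>t<s. ?L t)"
  proof (cases s)
    case (Suc r)
    show ?thesis
      unfolding Suc sum_subtractf by (simp add: bracket_sum_def sum_distrib_left lessThan_Suc_atMost)
  qed simp
  finally show ?thesis
    unfolding split \<eta> X G by simp
qed

end

subsection \<open>Operator products as sums over permutations\<close>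

text \<open>Arrangements are lists here because each operator peels letters off the head;
  permutation functions enter only at the end.\<close>

definition perm_sum :: "('k list \<Rightarrow> 'b::ring_1) \<Rightarrow> 'k set \<Rightarrow> 'b" where
  "perm_sum h A = (\<Sum>w\<in>permutations_of_set A. h w)"

lemma perm_sum_remove:
  assumes "A \<noteq> {}" "finite A"
  shows "perm_sum h A = (\<Sum>k\<in>A. perm_sum (\<lambda>w. h (k # w)) (A - {k}))"
proof -
  have "perm_sum h A = (\<Sum>k\<in>A. \<Sum>w\<in>(#) k ` permutations_of_set (A - {k}). h w)"
    unfolding perm_sum_def permutations_of_set_nonempty[OF assms(1)]
    by (rule sum.UNION_disjoint) (use assms in auto)
  then show ?thesis by (simp add: perm_sum_def sum.reindex)
qed

lemma letter_op_perm_sum: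
  "letter_op u (perm_sum h) = perm_sum (\<lambda>w. case w of [] \<Rightarrow> 0 | k # v \<Rightarrow> u k * h v)"
proof
  fix A
  show "letter_op u (perm_sum h) A = perm_sum (\<lambda>w. case w of [] \<Rightarrow> 0 | k # v \<Rightarrow> u k * h v) A"
  proof (cases "finite A \<and> A \<noteq> {}")
    case True
    then show ?thesis
      by (simp add: perm_sum_remove[of A] letter_op_def) (simp add: perm_sum_def sum_distrib_left)
  next
    case False
    then show ?thesis by (auto simp: letter_op_def perm_sum_def permutations_of_set_infinite)
  qed
qed

text \<open>The iterate consumes the first \<open>p\<close> letters of the word and hands the rest
  to \<open>h\<close>; words that are too short contribute 0, as \<open>letter_op\<close> does on
  the empty set.\<close>

lemma pow_letter_op_perm_sum:
  "(letter_op u ^^ p) (perm_sum h) =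
    perm_sum (\<lambda>w. if length w < p then 0 else prod_list (map u (take p w)) * h (drop p w))"
proof (induction p)
  case (Suc p)
  show ?case
    by (auto simp: Suc letter_op_perm_sum mult.assoc intro!: arg_cong[of _ _ perm_sum] split: list.split)
qed simp

lemma pair_op_perm_sum:
  "pair_op N (perm_sum h) =
    perm_sum (\<lambda>w. case w of k # l # v \<Rightarrow> N k l * h v | _ \<Rightarrow> 0)"
proof
  fix A
  show "pair_op N (perm_sum h) A = perm_sum (\<lambda>w. case w of k # l # v \<Rightarrow> N k l * h v | _ \<Rightarrow> 0) A"
  proof (cases "finite A \<and> A \<noteq> {}")
    case True
    then show ?thesis
      by (auto simp: perm_sum_remove[of A] pair_op_def letter_op_perm_sum
          intro!: sum.cong arg_cong2[of _ _ _ _ perm_sum] split: list.split)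
  next
    case False
    then show ?thesis by (auto simp: pair_op_def perm_sum_def permutations_of_set_infinite)
  qed
qed

text \<open>Listing the values of a permutation is injective, and both sides have the same
  cardinality \<open>fact m\<close>, so it is a bijection.\<close>

lemma perm_sum_permutes:
  "perm_sum h {..<m} = (\<Sum>\<sigma>\<in>{\<sigma>. \<sigma> permutes {..<m}}. h (map \<sigma> [0..<m]))"
proof -
  have "inj_on (\<lambda>\<sigma>. map \<sigma> [0..<m]) {\<sigma>. \<sigma> permutes {..<m}}"
  proof (intro inj_onI ext)
    fix \<sigma> \<tau> k
    assume *: "\<sigma> \<in> {\<sigma>. \<sigma> permutes {..<m}}" "\<tau> \<in> {\<sigma>. \<sigma> permutes {..<m}}"
      "map \<sigma> [0..<m] = map \<tau> [0..<m]"
    show "\<sigma> k = \<tau> k"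
      by (cases "k < m") (use * in \<open>auto simp: permutes_not_in\<close>)
  qed
  moreover have "(\<lambda>\<sigma>. map \<sigma> [0..<m]) ` {\<sigma>. \<sigma> permutes {..<m}} \<subseteq> permutations_of_set {..<m}"
    by (auto simp: permutations_of_set_def distinct_map permutes_inj_on permutes_image
        simp flip: atLeast0LessThan)
  ultimately have "bij_betw (\<lambda>\<sigma>. map \<sigma> [0..<m]) {\<sigma>. \<sigma> permutes {..<m}} (permutations_of_set {..<m})"
    by (intro bij_betw_imageI card_subset_eq)
      (auto simp: card_image card_permutations)
  then show ?thesis
    unfolding perm_sum_def by (rule sum.reindex_bij_betw[symmetric])
qed

context normal_ordering
begin

lemma pow_pair_op_perm_sum:
  "(pair_op Nb ^^ a) (perm_sum h) =
    perm_sum (\<lambda>w. if length w < 2 * a then 0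
      else sc (\<Prod>l<a. N (w ! (2 * l)) (w ! (2 * l + 1))) * h (drop (2 * a) w))"
proof (induction a)
  case (Suc a)
  show ?case
    by (auto simp: Suc pair_op_perm_sum prod.lessThan_Suc_shift sc_mult mult.assoc
        intro!: arg_cong[of _ _ perm_sum] split: list.split simp del: prod.lessThan_Suc)
qed simp

lemma ord_sum_eq_perm_sum:
  assumes "card A = 2 * a + p + q + t" 
  shows "ord_sum a p q t A = perm_sum (\<lambda>w. sc (\<Prod>l<a. N (w ! (2 * l)) (w ! (2 * l + 1)))
     * (prod_list (map X (take p (drop (2 * a) w)))
     * (prod_list (map G (take q (drop (2 * a + p) w)))
     * prod_list (map D (drop (2 * a + p + q) w))))) A"
proof -
  have unit: "(\<lambda>A :: 'k set. if A = {} then 1 else 0) = perm_sum (\<lambda>w. if w = [] then 1 else (0::'b))"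
  proof
    fix A :: "'k set"
    show "(if A = {} then 1 else 0) = perm_sum (\<lambda>w. if w = [] then 1 else (0::'b)) A"
      by (cases "A = {}") (auto simp: perm_sum_def dest: permutations_of_setD(1) intro!: sum.neutral[symmetric])
  qed
  \<comment> \<open>Every word has length \<open>2 * a + p + q + t\<close>, so none of the length
    guards fails and the base indicator sees the empty word.\<close>
  have "length w = card A" if "w \<in> permutations_of_set A" for w
    using that by (auto simp: permutations_of_set_def distinct_card)
  then show ?thesis
    unfolding ord_sum_def unit pow_letter_op_perm_sum pow_pair_op_perm_sum
    unfolding perm_sum_def using assms by (intro sum.cong refl) (simp add: add_ac)
qed

end

subsection \<open>The product formula\<close>

text \<open>The relations between letters, \<open>H\<close> and \<open>Y\<close> under which the
  formula is proved. Those for \<open>F\<close> follow from \<open>F\<close> being the square of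
  \<open>Y\<close>.\<close>

locale xhat_product = normal_ordering sc N X D G
  for sc :: "complex \<Rightarrow> 'b::ring_1" and N :: "'k \<Rightarrow> 'k \<Rightarrow> complex" and X D G :: "'k \<Rightarrow> 'b" +
  fixes H Y F :: 'b
  assumes X_H: "X k * H = (H + 1) * X k"
    and D_H: "D k * H = (H - 1) * D k"
    and G_H: "G k * H = H * G k"
    and Y_H: "Y * H = (H + 1) * Y"
    and X_Y: "X k * Y = Y * X k"
    and G_Y: "G k * Y = X k + X k - Y * G k"
    and D_Y: "D k * Y = Y * D k + G k"
    and Y_Y: "Y * Y = F"
begin

definition xhat_el :: "'k \<Rightarrow> 'b" where
  "xhat_el k = (H + 1) * X k + sc (1/2) * (Y * G k) + sc (1/2) * (F * D k)"

definition rising :: "nat \<Rightarrow> nat \<Rightarrow> 'b" where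
  "rising a b = prod_list (map (\<lambda>k. H + of_nat k) [a..<b])"

section \<open>Commutation of \<open>F\<close> with the letters\<close>

lemma X_F: "X k * F = F * X k"
  by (metis Y_Y X_Y mult.assoc)

text \<open>Crossing \<open>Y\<close> twice restores the sign, and the two terms
  \<open>2 * X k * Y\<close> arising on the way cancel.\<close>

lemma G_F: "G k * F = F * G k"
proof -
  have "G k * (Y * Y) = (X k + X k - Y * G k) * Y"
    by (simp add: G_Y flip: mult.assoc)
  also have "\<dots> = X k * Y + X k * Y - Y * (G k * Y)"
    by (simp add: algebra_simps)
  also have "\<dots> = Y * Y * G k"
    by (simp add: G_Y X_Y algebra_simps)
  finally show ?thesis by (simp add: Y_Y)
qed

lemma D_F: "D k * F = F * D k + X k + X k"
proof -
  have "D k * (Y * Y) = (Y * D k + G k) * Y"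
    by (simp add: D_Y flip: mult.assoc)
  also have "\<dots> = Y * (D k * Y) + G k * Y"
    by (simp add: algebra_simps)
  also have "\<dots> = Y * Y * D k + X k + X k"
    by (simp add: D_Y G_Y algebra_simps)
  finally show ?thesis by (simp add: Y_Y)
qed

lemma Y_F: "Y * F = F * Y"
  by (metis Y_Y mult.assoc)

text \<open>All three summands shift \<open>H\<close> by 1: \<open>X k\<close> by 1,
  \<open>Y\<close> by 1 and \<open>G k\<close> by 0, \<open>F\<close> by 2 and \<open>D k\<close> by
  -1.\<close>

lemma xhat_el_H: "xhat_el k * H = (H + 1) * xhat_el k"
proof -
  have FD: "F * D k * H = (H + 1) * (F * D k)"
  proof -
    have FH: "F * H = (H + 2) * F"
    proof -
      have "Y * Y * H = Y * (H + 1) * Y"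
        by (simp only: mult.assoc Y_H)
      also have "\<dots> = (H + 2) * (Y * Y)"
        by (simp add: distrib_left Y_H) (simp add: algebra_simps mult_2)
      finally show ?thesis by (simp only: Y_Y)
    qed
    have "F * D k * H = F * H * D k - F * D k"
      by (simp add: mult.assoc D_H algebra_simps)
    then show ?thesis by (simp add: FH algebra_simps mult_2)
  qed
  have YG: "Y * G k * H = (H + 1) * (Y * G k)"
    by (metis G_H Y_H mult.assoc)
  have XH: "(H + 1) * X k * H = (H + 1) * ((H + 1) * X k)"
    by (simp add: X_H mult.assoc)
  have "xhat_el k * H = (H + 1) * X k * H + sc (1/2) * (Y * G k * H) + sc (1/2) * (F * D k * H)"
    unfolding xhat_el_def by (simp add: algebra_simps)
  also have "\<dots> = (H + 1) * xhat_el k"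
    unfolding XH YG FD xhat_el_def distrib_left[of "H + 1"] sc_left_comm[of "H + 1"] ..
  finally show ?thesis .
qed

lemma xhat_el_rising: "xhat_el k * rising a b = rising (Suc a) (Suc b) * xhat_el k"
proof -
  have H: "xhat_el k * (H + of_nat j) = (H + of_nat (Suc j)) * xhat_el k" for j
    by (simp add: distrib_left distrib_right xhat_el_H mult_of_nat_commute add.assoc)
  have "xhat_el k * prod_list (map (\<lambda>k. H + of_nat k) js) =
      prod_list (map (\<lambda>k. H + of_nat (Suc k)) js) * xhat_el k" for js
  proof (induction js)
    case (Cons j js)
    have "xhat_el k * ((H + of_nat j) * z) = (H + of_nat (Suc j)) * (xhat_el k * z)" for z
      by (simp only: H mult.assoc flip: mult.assoc[of "xhat_el k"])
    with Cons show ?case by (simp add: mult.assoc del: of_nat_Suc)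
  qed simp
  then show ?thesis
    unfolding rising_def map_Suc_upt[symmetric] map_map comp_def .
qed

lemma rising_rec: "a < b \<Longrightarrow> rising (Suc a) b * (H + of_nat a) = rising a b"
proof -
  assume "a < b"
  have "prod_list (map (\<lambda>k. H + of_nat k) js) * (H + of_nat a) =
      (H + of_nat a) * prod_list (map (\<lambda>k. H + of_nat k) js)" for js
  proof (induction js)
    case (Cons j js)
    have "(H + of_nat j) * (H + of_nat a) = (H + of_nat a) * (H + of_nat j)"
      using mult_of_nat_commute[of j "of_nat a :: 'b"]
      by (simp add: distrib_left distrib_right mult_of_nat_commute[of _ H] add_ac)
    with Cons show ?case by simp (metis mult.assoc)
  qed simp
  with \<open>a < b\<close> show ?thesis
    by (simp add: rising_def upt_conv_Cons)
qed

section \<open>The action of one hat on the summands\<close>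

lemma pow_commute: "c * F = F * c \<Longrightarrow> c * F ^ r = F ^ r * c"
  by (metis power_commuting_commutes)

lemma F_D_pow: "F * D k * F ^ r = F ^ Suc r * D k + of_nat (2 * r) * (F ^ r * X k)"
proof (induction r)
  case (Suc r)
  have "F * D k * F ^ Suc r = F * D k * F ^ r * F"
    by (simp only: power_Suc2 mult.assoc)
  also have "\<dots> = F ^ Suc r * (D k * F) + of_nat (2 * r) * (F ^ r * (X k * F))"
    unfolding Suc by (simp add: algebra_simps)
  also have "F ^ r * (X k * F) = F ^ Suc r * X k"
    unfolding X_F by (simp only: power_Suc2 mult.assoc)
  also have "F ^ Suc r * (D k * F) = F ^ Suc (Suc r) * D k + of_nat 2 * (F ^ Suc r * X k)"
    unfolding D_F by (simp only: power_Suc2 mult.assoc distrib_left) (simp add: mult_2 algebra_simps)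
  finally show ?case by (simp add: algebra_simps mult_2)
qed simp

text \<open>Half of the \<open>2 * r\<close> terms \<open>F ^ r * X k\<close> from
  \<open>F_D_pow\<close> turns the factor \<open>H + 1\<close> into
  \<open>H + 1 + r\<close>.\<close>

lemma xhat_el_F: "xhat_el k * F ^ r = (H + of_nat (Suc r)) * (F ^ r * X k)
    + sc (1/2) * (F ^ r * (Y * G k)) + sc (1/2) * (F ^ r * (F * D k))"
proof -
  have X: "X k * F ^ r = F ^ r * X k" and YG: "Y * G k * F ^ r = F ^ r * (Y * G k)"
    using G_F Y_F by (auto intro!: pow_commute simp: X_F) (metis mult.assoc)
  have "sc (1/2) * (of_nat (2 * r) * y) = of_nat r * y" for y :: 'b
    using half_double[of "of_nat r * y"] by (simp add: mult_2 algebra_simps)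
  moreover have "F ^ Suc r * D k = F ^ r * (F * D k)"
    by (simp only: power_Suc2 mult.assoc)
  ultimately have FD: "sc (1/2) * (F * D k * F ^ r) = sc (1/2) * (F ^ r * (F * D k)) + of_nat r * (F ^ r * X k)"
    unfolding F_D_pow distrib_left by simp
  have "xhat_el k * F ^ r = (H + 1) * (X k * F ^ r) + sc (1/2) * (Y * G k * F ^ r) + sc (1/2) * (F * D k * F ^ r)"
    unfolding xhat_el_def by (simp only: mult.assoc distrib_right)
  then show ?thesis
    unfolding X YG FD by (simp add: algebra_simps)
qed

text \<open>The core computation: \<open>z\<close> collects what stays in the same power of
  \<open>F\<close>, \<open>y\<close> what gains a factor \<open>F\<close>. The Clifford and
  derivative parts of the hat together contribute \<open>2 * z\<close>, and half of this raises
  \<open>H + r + 1\<close> to \<open>H + r + 2\<close>.\<close>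

lemma xhat_el_term:
  "xhat_el k * (F ^ r * (Y * v + F * u)) =
    (H + of_nat (Suc (Suc r))) * (F ^ r * (Y * (X k * v) + F * (X k * u)))
    + sc (1/2) * (F ^ Suc r * (Y * (D k * v + G k * u) + F * (D k * u)))"
proof -
  define z where "z = Y * (X k * v) + F * (X k * u)"
  define y where "y = F * (Y * (D k * v + G k * u) + F * (D k * u))"
  have 1: "X k * (Y * v + F * u) = z"
    unfolding z_def distrib_left by (metis X_F X_Y mult.assoc)
  have YG: "Y * G k * (Y * v + F * u) = Y * (X k * v) + Y * (X k * v) - F * (G k * v) + F * (Y * (G k * u))"
  proof -
    have "Y * G k * (Y * v) = Y * (G k * Y) * v" by (simp only: mult.assoc)
    also have "\<dots> = Y * (X k * v) + Y * (X k * v) - Y * Y * (G k * v)"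
      unfolding G_Y by (simp add: algebra_simps)
    finally have "Y * G k * (Y * v) = Y * (X k * v) + Y * (X k * v) - F * (G k * v)" by (simp add: Y_Y)
    moreover have "Y * G k * (F * u) = F * (Y * (G k * u))" by (metis G_F Y_F mult.assoc)
    ultimately show ?thesis by (simp add: distrib_left)
  qed
  have FD: "F * D k * (Y * v + F * u) =
      F * (Y * (D k * v)) + F * (G k * v) + F * (F * (D k * u)) + F * (X k * u) + F * (X k * u)"
  proof -
    have "F * D k * (Y * v + F * u) = F * (D k * Y) * v + F * (D k * F) * u"
      by (simp only: mult.assoc distrib_left)
    then show ?thesis unfolding D_Y D_F by (simp add: algebra_simps)
  qed
  \<comment> \<open>The terms \<open>F * (G k * v)\<close> from the anticommutation with
    \<open>Y\<close> and from differentiating \<open>Y\<close> have opposite signs and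
    cancel.\<close>
  have 2: "Y * G k * (Y * v + F * u) + F * D k * (Y * v + F * u) = z + z + y"
    unfolding YG FD z_def y_def by (simp add: algebra_simps)
  have "xhat_el k * (F ^ r * (Y * v + F * u)) = xhat_el k * F ^ r * (Y * v + F * u)"
    by (simp only: mult.assoc)
  also have "\<dots> = (H + of_nat (Suc r)) * (F ^ r * (X k * (Y * v + F * u)))
      + sc (1/2) * (F ^ r * (Y * G k * (Y * v + F * u) + F * D k * (Y * v + F * u)))"
    unfolding xhat_el_F by (simp only: mult.assoc distrib_left distrib_right add_ac)
  also have "\<dots> = (H + of_nat (Suc r)) * (F ^ r * z)
      + (sc (1/2) * (F ^ r * z) + sc (1/2) * (F ^ r * z)) + sc (1/2) * (F ^ r * y)"
    unfolding 1 2 by (simp only: distrib_left add.assoc)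
  also have "\<dots> = (H + of_nat (Suc (Suc r))) * (F ^ r * z) + sc (1/2) * (F ^ r * y)"
    unfolding half_double by (simp add: algebra_simps)
  also have "F ^ r * y = F ^ Suc r * (Y * (D k * v + G k * u) + F * (D k * u))"
    unfolding y_def by (simp only: power_Suc2 mult.assoc)
  finally show ?thesis by (simp only: z_def)
qed

section \<open>Induction on the number of hats\<close>

lemma ord_sum_empty: "ord_sum 0 0 0 0 {} = 1"
  by (simp add: ord_sum_def)

lemma bracket_sum_X: "distinct ks \<Longrightarrow> bracket_sum 0 0 (int (length ks)) (set ks) = prod_list (map X ks)"
proof (induction ks)
  case Nil
  then show ?case by (simp add: bracket_sum_def nbracket_def ord_sum_empty)
next
  case (Cons i ks)
  then show ?case using bracket_sum_insert[of "set ks" i 0 0 "int (length (i # ks))"] by simp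
qed

lemma bracket_sum_neg: "c < 0 \<Longrightarrow> bracket_sum q s c A = 0"
  by (simp add: bracket_sum_def nbracket_def)

text \<open>The case \<open>q = 0\<close> is the plain word in the X and stands apart because the
  exponent \<open>q - 1\<close> would truncate.\<close>

definition summand :: "nat \<Rightarrow> 'k set \<Rightarrow> nat \<Rightarrow> 'b" where
  "summand m A q = (if q = 0 then bracket_sum 0 0 (int m) A else F ^ (q - 1) *
    (Y * bracket_sum 1 (q - 1) (int m - int q) A + F * bracket_sum 0 q (int m - int q) A))"

theorem prod_xhat_el:
  "distinct ks \<Longrightarrow> prod_list (map xhat_el ks) =
    (\<Sum>q\<le>length ks. sc (1 / 2 ^ q) * (rising (Suc q) (Suc (length ks)) * summand (length ks) (set ks) q))"
proof (induction ks)
  case Nil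
  show ?case by (simp add: rising_def summand_def bracket_sum_def nbracket_def ord_sum_empty)
next
  case (Cons i ks)
  define A where "A = set ks"
  define m where "m = length ks"
  have A: "finite A" "i \<notin> A" using Cons.prems by (auto simp: A_def)
  \<comment> \<open>The summand for the enlarged set splits into \<open>a q\<close>, where
    \<open>i\<close> enters through X, and \<open>b (q - 1)\<close>, where it enters through D or G
    and \<open>q\<close> grows by one. The same \<open>a q\<close> and \<open>b q\<close> come out
    of multiplying the old summand by the hat.\<close>
  define a where "a q = (if q = 0 then X i * bracket_sum 0 0 (int m) A else F ^ (q - 1) *
    (Y * (X i * bracket_sum 1 (q - 1) (int m - int q) A) + F * (X i * bracket_sum 0 q (int m - int q) A)))" for q
  define b where "b q = F ^ q *
    (Y * ((if q = 0 then 0 else D i * bracket_sum 1 (q - 1) (int m - int q) A) + G i * bracket_sum 0 q (int m - int q) A)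
      + F * (D i * bracket_sum 0 q (int m - int q) A))" for q
  have summand_insert: "summand (Suc m) (insert i A) q = a q + (case q of 0 \<Rightarrow> 0 | Suc r \<Rightarrow> b r)" for q
    by (cases q) (simp_all add: summand_def a_def b_def bracket_sum_insert[OF A] algebra_simps)
  have xhat_el_summand: "xhat_el i * summand m A q = (H + of_nat (Suc q)) * a q + sc (1/2) * b q" for q
  proof (cases q)
    case 0
    then show ?thesis
      by (simp add: summand_def a_def b_def xhat_el_def algebra_simps)
  next
    case (Suc r)
    then show ?thesis
      using xhat_el_term[of i r "bracket_sum 1 r (int m - int q) A" "bracket_sum 0 q (int m - int q) A"]
      by (simp add: summand_def a_def b_def)
  qed
  \<comment> \<open>At \<open>q = m + 1\<close> the number of letters X would be negative; this lets
    the sum of the \<open>a q\<close> be extended to \<open>m + 1\<close>.\<close>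
  have a_top: "a (Suc m) = 0"
    by (simp add: a_def bracket_sum_neg)
  have distr: "s * (p * (y * z + w)) = s * (p * y * z) + s * (p * w)" for s p y z w :: 'b
    by (simp only: distrib_left mult.assoc)
  have step: "xhat_el i * (sc (1 / 2 ^ q) * (rising (Suc q) (Suc m) * summand m A q)) =
      sc (1 / 2 ^ q) * (rising (Suc q) (Suc (Suc m)) * a q)
      + sc (1 / 2 ^ Suc q) * (rising (Suc (Suc q)) (Suc (Suc m)) * b q)" if "q \<le> m" for q
  proof -
    have "xhat_el i * (sc (1 / 2 ^ q) * (rising (Suc q) (Suc m) * summand m A q)) =
        sc (1 / 2 ^ q) * (xhat_el i * rising (Suc q) (Suc m) * summand m A q)"
      by (simp only: mult.assoc sc_left_comm[of "xhat_el i"])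
    also have "\<dots> = sc (1 / 2 ^ q) * (rising (Suc (Suc q)) (Suc (Suc m)) * (xhat_el i * summand m A q))"
      by (simp only: xhat_el_rising mult.assoc)
    also have "\<dots> = sc (1 / 2 ^ q) * (rising (Suc (Suc q)) (Suc (Suc m)) * (H + of_nat (Suc q)) * a q)
        + sc (1 / 2 ^ q) * (rising (Suc (Suc q)) (Suc (Suc m)) * (sc (1/2) * b q))"
      unfolding xhat_el_summand by (rule distr)
    \<comment> \<open>Moving the hat past the product shifted its lowest factor to
      \<open>H + q + 2\<close>; the factor \<open>H + q + 1\<close> created by the hat fills the
      gap.\<close>
    also have "rising (Suc (Suc q)) (Suc (Suc m)) * (H + of_nat (Suc q)) = rising (Suc q) (Suc (Suc m))"
      by (rule rising_rec) (use that in simp)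
    also have "sc (1 / 2 ^ q) * (rising (Suc (Suc q)) (Suc (Suc m)) * (sc (1/2) * b q)) =
        sc (1 / 2 ^ q) * sc (1/2) * (rising (Suc (Suc q)) (Suc (Suc m)) * b q)"
      by (simp only: mult.assoc sc_left_comm[of "rising _ _"])
    also have "sc (1 / 2 ^ q) * sc (1/2) = sc (1 / 2 ^ Suc q)"
      by (simp only: sc_mult[symmetric]) (simp add: mult.commute)
    finally show ?thesis .
  qed
  have "prod_list (map xhat_el (i # ks)) =
      (\<Sum>q\<le>m. xhat_el i * (sc (1 / 2 ^ q) * (rising (Suc q) (Suc m) * summand m A q)))"
    using Cons unfolding m_def A_def sum_distrib_left[symmetric] by simp
  also have "\<dots> = (\<Sum>q\<le>m. sc (1 / 2 ^ q) * (rising (Suc q) (Suc (Suc m)) * a q))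
      + (\<Sum>q\<le>m. sc (1 / 2 ^ Suc q) * (rising (Suc (Suc q)) (Suc (Suc m)) * b q))"
    unfolding sum.distrib[symmetric] by (intro sum.cong refl step) simp
  also have "(\<Sum>q\<le>m. sc (1 / 2 ^ q) * (rising (Suc q) (Suc (Suc m)) * a q)) =
      (\<Sum>q\<le>Suc m. sc (1 / 2 ^ q) * (rising (Suc q) (Suc (Suc m)) * a q))"
    by (simp add: a_top)
  also have "(\<Sum>q\<le>m. sc (1 / 2 ^ Suc q) * (rising (Suc (Suc q)) (Suc (Suc m)) * b q)) =
      (\<Sum>q\<le>Suc m. sc (1 / 2 ^ q) * (rising (Suc q) (Suc (Suc m)) * (case q of 0 \<Rightarrow> 0 | Suc r \<Rightarrow> b r)))"
    by (subst sum.atMost_Suc_shift) simp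
  also have "(\<Sum>q\<le>Suc m. sc (1 / 2 ^ q) * (rising (Suc q) (Suc (Suc m)) * a q)) + \<dots> =
      (\<Sum>q\<le>Suc m. sc (1 / 2 ^ q) * (rising (Suc q) (Suc (Suc m)) * summand (Suc m) (insert i A) q))"
    by (simp only: sum.distrib[symmetric] distrib_left[symmetric] summand_insert)
  finally show ?case by (simp add: m_def A_def)
qed

end

subsection \<open>Relations in the Weyl--Clifford algebra\<close>

locale weyl_clifford =
  fixes n :: nat and eta etal :: "nat \<Rightarrow> nat \<Rightarrow> complex" and sc :: "complex \<Rightarrow> 'b::ring_1"
    and x d g :: "nat \<Rightarrow> 'b"
  assumes metric: "metric n eta etal" and alg: "WC_alg n eta sc x d g"
begin

sublocale central_scalars sc
  using alg by unfold_locales (simp add: WC_alg_def)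

lemma x_x: "i < n \<Longrightarrow> j < n \<Longrightarrow> x i * x j = x j * x i"
  and d_d: "i < n \<Longrightarrow> j < n \<Longrightarrow> d i * d j = d j * d i"
  and g_x: "i < n \<Longrightarrow> j < n \<Longrightarrow> g i * x j = x j * g i"
  and g_d: "i < n \<Longrightarrow> j < n \<Longrightarrow> g i * d j = d j * g i"
  using alg by (simp_all add: WC_alg_def)

lemma d_x: "i < n \<Longrightarrow> j < n \<Longrightarrow> d i * x j = x j * d i + (if i = j then 1 else 0)"
proof -
  assume "i < n" "j < n"
  then have "d i * x j - x j * d i = (if i = j then 1 else 0)"
    using alg by (simp add: WC_alg_def)
  then show ?thesis by (simp only: diff_eq_eq add.commute)
qed

lemma g_g: "i < n \<Longrightarrow> j < n \<Longrightarrow> g i * g j = sc (2 * eta i j) - g j * g i"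
proof -
  assume "i < n" "j < n"
  then have "g i * g j + g j * g i = sc (2 * eta i j)"
    using alg by (simp add: WC_alg_def)
  then show ?thesis by (simp only: eq_diff_eq)
qed

lemma eta_sym: "i < n \<Longrightarrow> j < n \<Longrightarrow> eta i j = eta j i"
  and eta_etal: "i < n \<Longrightarrow> k < n \<Longrightarrow> (\<Sum>j<n. eta i j * etal j k) = (if i = k then 1 else 0)"
  and etal_eta: "i < n \<Longrightarrow> k < n \<Longrightarrow> (\<Sum>j<n. etal i j * eta j k) = (if i = k then 1 else 0)"
  using metric unfolding metric_def by blast+

abbreviation "D \<equiv> dup n eta sc d"
abbreviation "xl \<equiv> xlow n etal sc x"
abbreviation "H \<equiv> Hop n sc x d"
abbreviation "Y \<equiv> Ytil n etal sc x g"
abbreviation "F \<equiv> Ftil n etal sc x"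

lemma delta_sum: "j < n \<Longrightarrow> (\<Sum>k<n. f k * (if k = j then 1 else 0)) = (f j :: 'b)"
  by (simp add: if_distrib[of "(*) _"] cong: if_cong)

section \<open>Relations for raised and lowered generators\<close>

lemma D_D: "i < n \<Longrightarrow> j < n \<Longrightarrow> D i * D j = D j * D i"
proof -
  assume "i < n" "j < n"
  have "D i * D j = (\<Sum>k<n. \<Sum>l<n. sc (eta i k) * (sc (eta j l) * (d k * d l)))"
    unfolding dup_def sum_product by (simp add: mult.assoc sc_left_comm[of "d _"])
  also have "\<dots> = (\<Sum>l<n. \<Sum>k<n. sc (eta j l) * (sc (eta i k) * (d l * d k)))"
  proof (subst sum.swap, intro sum.cong refl)
    fix k l assume "k \<in> {..<n}" "l \<in> {..<n}"
    then show "sc (eta i k) * (sc (eta j l) * (d k * d l)) = sc (eta j l) * (sc (eta i k) * (d l * d k))"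
      using d_d[of k l] sc_left_comm[of "sc (eta i k)" "eta j l"] by simp
  qed
  also have "\<dots> = D j * D i"
    unfolding dup_def sum_product by (simp add: mult.assoc sc_left_comm[of "d _"])
  finally show ?thesis .
qed

lemma D_x: "i < n \<Longrightarrow> j < n \<Longrightarrow> D i * x j = x j * D i + sc (eta i j)"
  unfolding dup_def
  by (simp add: sum_distrib_left sum_distrib_right mult.assoc d_x distrib_left sum.distrib
      sc_left_comm[of "x j"] delta_sum)

lemma g_D: "i < n \<Longrightarrow> j < n \<Longrightarrow> g i * D j = D j * g i"
  unfolding dup_def
  by (simp add: sum_distrib_left sum_distrib_right mult.assoc g_d sc_left_comm[of "g i"])

lemma x_xl: "i < n \<Longrightarrow> k < n \<Longrightarrow> x i * xl k = xl k * x i"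
  unfolding xlow_def
  by (auto simp: sum_distrib_left sum_distrib_right mult.assoc sc_left_comm[of "x i"] x_x
      intro!: sum.cong)

lemma g_xl: "i < n \<Longrightarrow> k < n \<Longrightarrow> g i * xl k = xl k * g i"
  unfolding xlow_def
  by (simp add: sum_distrib_left sum_distrib_right mult.assoc sc_left_comm[of "g i"] g_x)

lemma eta_xl: "i < n \<Longrightarrow> (\<Sum>k<n. sc (eta i k) * xl k) = x i"
proof -
  assume i: "i < n"
  have "(\<Sum>k<n. sc (eta i k) * xl k) = (\<Sum>k<n. \<Sum>j<n. sc (eta i k * etal k j) * x j)"
    by (simp add: xlow_def sum_distrib_left sc_mult mult.assoc)
  also have "\<dots> = (\<Sum>j<n. sc (\<Sum>k<n. eta i k * etal k j) * x j)"
    by (subst sum.swap) (simp add: sc_sum sum_distrib_right)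
  also have "\<dots> = (\<Sum>j<n. if j = i then x j else 0)"
    using i by (intro sum.cong) (auto simp: eta_etal sc_0 sc_1)
  finally show ?thesis using i by simp
qed

lemma D_xl: "i < n \<Longrightarrow> k < n \<Longrightarrow> D i * xl k = xl k * D i + (if i = k then 1 else 0)"
proof -
  assume i: "i < n" and k: "k < n"
  have "D i * xl k = (\<Sum>j<n. sc (etal k j) * (x j * D i + sc (eta i j)))"
    using i by (simp add: xlow_def sum_distrib_left sc_left_comm[of "D i"] D_x)
  also have "\<dots> = xl k * D i + sc (\<Sum>j<n. etal k j * eta i j)"
    by (simp add: xlow_def sum_distrib_right distrib_left sum.distrib sc_sum sc_mult mult.assoc)
  also have "(\<Sum>j<n. etal k j * eta i j) = (\<Sum>j<n. etal k j * eta j i)"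
    using i by (intro sum.cong) (auto simp: eta_sym)
  finally show ?thesis using i k by (auto simp: etal_eta sc_0 sc_1)
qed

text \<open>Up to a constant, \<open>H\<close> is minus the Euler operator, so \<open>x i\<close>
  shifts it by one. In the commutator with the symmetrised sum only \<open>k = i\<close> survives
  and gives \<open>2 * x i\<close>, which the prefactor -1/2 normalises.\<close>

lemma x_H: "i < n \<Longrightarrow> x i * H = (H + 1) * x i"
proof -
  assume i: "i < n"
  define S where "S = (\<Sum>k<n. d k * x k + x k * d k)"
  have dx: "x i * d k = d k * x i - (if k = i then 1 else 0)" if "k < n" for k
    using d_x[OF that i] by simp
  have "x i * (d k * x k + x k * d k) = (d k * x k + x k * d k) * x i
      - (x k + x k) * (if k = i then 1 else 0)" if k: "k < n" for k
  proof -
    have "x i * (d k * x k + x k * d k) = x i * d k * x k + x k * (x i * d k)"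
      using x_x[OF i k] by (simp add: distrib_left flip: mult.assoc)
    also have "\<dots> = (d k * x k + x k * d k) * x i - (x k + x k) * (if k = i then 1 else 0)"
      unfolding dx[OF k] using x_x[OF i k] by (auto simp: algebra_simps)
    finally show ?thesis .
  qed
  then have "x i * S = (\<Sum>k<n. (d k * x k + x k * d k) * x i - (x k + x k) * (if k = i then 1 else 0))"
    by (simp add: S_def sum_distrib_left)
  also have "\<dots> = S * x i - (x i + x i)"
    unfolding sum_subtractf delta_sum[OF i] by (simp add: S_def sum_distrib_right)
  finally have "x i * S = S * x i - (x i + x i)" .
  then show ?thesis
    unfolding Hop_def S_def[symmetric] sc_left_comm[of "x i"]
    by (simp only: distrib_left[of "sc _"] right_diff_distrib)
      (use neg_half[of "x i"] in \<open>simp add: algebra_simps\<close>)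
qed

lemma d_H: "i < n \<Longrightarrow> d i * H = (H - 1) * d i"
proof -
  assume i: "i < n"
  define S where "S = (\<Sum>k<n. d k * x k + x k * d k)"
  have "d i * (d k * x k + x k * d k) = (d k * x k + x k * d k) * d i
      + (d k + d k) * (if k = i then 1 else 0)" if k: "k < n" for k
  proof -
    have "d i * (d k * x k + x k * d k) = d k * (d i * x k) + d i * x k * d k"
      using d_d[OF i k] by (simp add: distrib_left flip: mult.assoc)
    also have "\<dots> = (d k * x k + x k * d k) * d i + (d k + d k) * (if k = i then 1 else 0)"
      unfolding d_x[OF i k] using d_d[OF i k] by (auto simp: algebra_simps)
    finally show ?thesis .
  qed
  then have "d i * S = (\<Sum>k<n. (d k * x k + x k * d k) * d i + (d k + d k) * (if k = i then 1 else 0))"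
    by (simp add: S_def sum_distrib_left)
  also have "\<dots> = S * d i + (d i + d i)"
    unfolding sum.distrib delta_sum[OF i] by (simp add: S_def sum_distrib_right)
  finally have "d i * S = S * d i + (d i + d i)" .
  then show ?thesis
    unfolding Hop_def S_def[symmetric] sc_left_comm[of "d i"]
    by (simp only: distrib_left[of "sc _"] right_diff_distrib)
      (use neg_half[of "d i"] in \<open>simp add: algebra_simps\<close>)
qed

lemma g_H: "i < n \<Longrightarrow> g i * H = H * g i"
proof -
  assume i: "i < n"
  have "g i * (d k * x k + x k * d k) = (d k * x k + x k * d k) * g i" if "k < n" for k
    using g_x[OF i that] g_d[OF i that] by (simp add: distrib_left distrib_right) (metis mult.assoc)
  then show ?thesis
    by (simp add: Hop_def sc_left_comm[of "g i"] sum_distrib_left sum_distrib_right mult.assoc)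
qed

lemma D_H: "i < n \<Longrightarrow> D i * H = (H - 1) * D i"
  unfolding dup_def
  by (simp add: sum_distrib_left sum_distrib_right mult.assoc d_H sc_left_comm[of "H - 1"])

lemma Y_H: "Y * H = (H + 1) * Y"
proof -
  have "xl k * H = (H + 1) * xl k" for k
    unfolding xlow_def
    by (simp add: sum_distrib_left sum_distrib_right mult.assoc x_H sc_left_comm[of "H + 1"])
  then have "xl k * g k * H = (H + 1) * (xl k * g k)" if "k < n" for k
    using g_H[OF that] by (metis mult.assoc)
  then show ?thesis
    by (simp add: Ytil_def sum_distrib_left sum_distrib_right)
qed

lemma x_Y: "i < n \<Longrightarrow> x i * Y = Y * x i"
proof -
  assume i: "i < n"
  have "x i * (xl k * g k) = xl k * g k * x i" if "k < n" for k
    using x_xl[OF i that] g_x[OF that i] by (metis mult.assoc)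
  then show ?thesis by (simp add: Ytil_def sum_distrib_left sum_distrib_right)
qed

lemma g_Y: "i < n \<Longrightarrow> g i * Y = x i + x i - Y * g i"
proof -
  assume i: "i < n"
  have "g i * (xl k * g k) = sc (eta i k) * xl k + sc (eta i k) * xl k - xl k * g k * g i"
    if k: "k < n" for k
  proof -
    have "g i * (xl k * g k) = xl k * (g i * g k)"
      using g_xl[OF i k] by (metis mult.assoc)
    then show ?thesis
      unfolding g_g[OF i k] sc_2[symmetric] by (simp add: right_diff_distrib sc_comm[of _ "xl k"] mult.assoc)
  qed
  then have "g i * Y = (\<Sum>k<n. sc (eta i k) * xl k + sc (eta i k) * xl k - xl k * g k * g i)"
    by (simp add: Ytil_def sum_distrib_left)
  then show ?thesis
    by (simp add: sum_subtractf sum.distrib eta_xl[OF i] Ytil_def sum_distrib_right)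
qed

lemma D_Y: "i < n \<Longrightarrow> D i * Y = Y * D i + g i"
proof -
  assume i: "i < n"
  have "D i * (xl k * g k) = xl k * g k * D i + g k * (if k = i then 1 else 0)" if k: "k < n" for k
  proof -
    have "D i * (xl k * g k) = (xl k * D i + (if i = k then 1 else 0)) * g k"
      unfolding D_xl[OF i k, symmetric] by (simp add: mult.assoc)
    then show ?thesis using g_D[OF k i] by (simp add: distrib_right mult.assoc)
  qed
  then have "D i * Y = (\<Sum>k<n. xl k * g k * D i + g k * (if k = i then 1 else 0))"
    by (simp add: Ytil_def sum_distrib_left)
  then show ?thesis
    unfolding sum.distrib delta_sum[OF i] by (simp add: Ytil_def sum_distrib_right)
qed

text \<open>Moving \<open>Y\<close> through the gammas gives \<open>Y * Y = 2 * F - Y * Y\<close>;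
  halving is possible because the ring contains the complex scalars.\<close>

lemma Y_Y: "Y * Y = F"
proof -
  have "Y * Y = (\<Sum>k<n. xl k * (g k * Y))"
    by (subst (1) Ytil_def) (simp add: sum_distrib_right mult.assoc)
  also have "\<dots> = (\<Sum>k<n. xl k * x k + xl k * x k - xl k * (Y * g k))"
    by (simp add: g_Y algebra_simps)
  also have "(\<Sum>k<n. xl k * x k + xl k * x k - xl k * (Y * g k)) = F + F - (\<Sum>k<n. xl k * (Y * g k))"
    by (simp add: sum_subtractf sum.distrib Ftil_def)
  also have "(\<Sum>k<n. xl k * (Y * g k)) = Y * Y"
  proof -
    have "xl k * Y = Y * xl k" for k
      unfolding xlow_def
      by (simp add: sum_distrib_left sum_distrib_right mult.assoc x_Y sc_left_comm[of Y])
    then have "(\<Sum>k<n. xl k * (Y * g k)) = (\<Sum>k<n. Y * (xl k * g k))"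
      by (simp only: mult.assoc[symmetric])
    then show ?thesis by (simp add: Ytil_def sum_distrib_left)
  qed
  finally have "Y * Y + Y * Y = F + F" by (simp only: eq_diff_eq)
  then have "sc (1/2) * (Y * Y + Y * Y) = sc (1/2) * (F + F)" by (rule arg_cong)
  then show ?thesis unfolding half .
qed

lemma xhat_eq:
  assumes "i < n"
  shows "xhat n eta etal sc x d g i = (H + 1) * x i + sc (1/2) * (Y * g i) + sc (1/2) * (F * D i)"
proof -
  have "(\<Sum>j<n. g j * xl j * g i) = Y * g i"
    by (simp add: Ytil_def sum_distrib_right g_xl)
  moreover have "(\<Sum>j<n. x j * xl j) = F"
    by (simp add: Ftil_def x_xl)
  ultimately show ?thesis by (simp add: xhat_def mult.assoc)
qed

text \<open>The product formula is applied to the positions \<open>0, ..., m - 1\<close>, and the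
  abstract brackets are identified with the given ones.\<close>

theorem prod_xhat:
  assumes "n \<ge> 1" and m: "length idx = m" and idx: "\<forall>i\<in>set idx. i < n"
  shows "prod_list (map (\<lambda>j. xhat n eta etal sc x d g (idx ! j)) [0..<m])
     = prod_list (map (\<lambda>k. H + of_nat k) [1..<m+1])
           * prod_list (map (\<lambda>j. x (idx ! j)) [0..<m])
       + (\<Sum>q=1..m.
            sc (1 / 2 ^ q) * prod_list (map (\<lambda>k. H + of_nat k) [q+1..<m+1])
            * F ^ (q - 1)
            * (Y * (\<Sum>t=0..q-1. bracket n eta sc x d g t (int m - int q - int t) 1 (q - 1 - t) idx)
              + F * (\<Sum>t=0..q. bracket n eta sc x d g t (int m - int q - int t) 0 (q - t) idx)))"
proof -
  \<comment> \<open>The locale requires its relations for every natural number, so positions outside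
    the list receive the default index 0, which is valid because \<open>n \<ge> 1\<close>.\<close>
  define \<iota> where "\<iota> k = (if k < m then idx ! k else 0)" for k
  have \<iota>: "\<iota> k < n" for k
    using assms by (auto simp: \<iota>_def)
  interpret xhat_product sc "\<lambda>k l. eta (\<iota> k) (\<iota> l)"
      "\<lambda>k. x (\<iota> k)" "\<lambda>k. D (\<iota> k)" "\<lambda>k. g (\<iota> k)" H Y F
    by unfold_locales
      (simp_all add: \<iota> scalar eta_sym x_x D_D D_x g_x g_D x_H D_H g_H Y_H x_Y g_Y D_Y Y_Y)
  have bracket: "bracket n eta sc x d g a p q t idx = nbracket a p q t {..<m}"
    if "2 * int a + p + int q + int t = int m" for a p q t
  proof (cases "p < 0")
    case False
    then have m': "m = 2 * a + nat p + q + t" using that by linarith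
    have "bracket n eta sc x d g a p q t idx = sc (1 / (2 ^ a * fact a * fact (nat p) * fact t)) *
      (\<Sum>\<sigma>\<in>{\<sigma>. \<sigma> permutes {..<m}}.
          sc (\<Prod>l<a. eta (\<iota> (\<sigma> (2*l))) (\<iota> (\<sigma> (2*l+1))))
          * prod_list (map (\<lambda>j. x (\<iota> (\<sigma> j))) [2*a..<2*a+nat p])
          * prod_list (map (\<lambda>j. g (\<iota> (\<sigma> j))) [2*a+nat p..<2*a+nat p+q])
          * prod_list (map (\<lambda>j. D (\<iota> (\<sigma> j))) [2*a+nat p+q..<m]))"
    proof -
      \<comment> \<open>A permutation of \<open>{..<m}\<close> keeps positions inside the list, so
        the default value is never read.\<close>
      have *: "idx ! \<sigma> j = \<iota> (\<sigma> j)" if "\<sigma> permutes {..<m}" "j < m" for \<sigma> j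
        using permutes_in_image[OF that(1), of j] that(2) by (simp add: \<iota>_def)
      show ?thesis
        unfolding bracket_def Let_def m using False m'
        by (auto intro!: arg_cong2[of _ _ _ _ "(*)"] sum.cong prod.cong
            arg_cong[of _ _ prod_list] arg_cong[of _ _ sc] simp: *)
    qed
    also have "\<dots> = nbracket a p q t {..<m}"
    proof -
      show ?thesis
        using False m'
        by (subst nbracket_def, subst ord_sum_eq_perm_sum)
          (auto simp: perm_sum_permutes take_map drop_map drop_upt take_upt mult.assoc comp_def
            intro!: arg_cong2[of _ _ _ _ "(*)"] sum.cong prod.cong arg_cong[of _ _ sc])
    qed
    finally show ?thesis .
  qed (simp add: bracket_def nbracket_def)
  \<comment> \<open>With \<open>s + r = q\<close> the degrees
    \<open>2 * t + (m - q - t) + r + (s - t)\<close> add up to \<open>m\<close>, as the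
    identification of brackets demands.\<close>
  have sums: "(\<Sum>t=0..s. bracket n eta sc x d g t (int m - int q - int t) r (s - t) idx) =
      bracket_sum r s (int m - int q) {..<m}" if "s + r = q" for q r s
    using that by (auto simp: bracket_sum_def atMost_atLeast0 intro!: sum.cong bracket)
  have "prod_list (map (\<lambda>j. xhat n eta etal sc x d g (idx ! j)) [0..<m]) = prod_list (map xhat_el [0..<m])"
  proof (intro arg_cong[of _ _ prod_list] map_cong refl)
    fix j assume "j \<in> set [0..<m]"
    then have "idx ! j = \<iota> j" by (simp add: \<iota>_def)
    then show "xhat n eta etal sc x d g (idx ! j) = xhat_el j"
      using \<iota>[of j] by (simp add: xhat_el_def xhat_eq)
  qed
  also have "\<dots> = (\<Sum>q\<le>m. sc (1 / 2 ^ q) * (rising (Suc q) (Suc m) * summand m {..<m} q))"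
    using prod_xhat_el[of "[0..<m]"] by (simp add: atLeast0LessThan)
  also have "{..m} = insert 0 {1..m}" by auto
  also have "(\<Sum>q\<in>insert 0 {1..m}. sc (1 / 2 ^ q) * (rising (Suc q) (Suc m) * summand m {..<m} q)) =
      rising 1 (Suc m) * summand m {..<m} 0 + (\<Sum>q=1..m. sc (1 / 2 ^ q) * (rising (Suc q) (Suc m) * summand m {..<m} q))"
    by (subst sum.insert) auto
  also have "summand m {..<m} 0 = prod_list (map (\<lambda>j. x (idx ! j)) [0..<m])"
  proof -
    have "summand m {..<m} 0 = prod_list (map (\<lambda>j. x (\<iota> j)) [0..<m])"
      using bracket_sum_X[of "[0..<m]"] by (simp add: summand_def atLeast0LessThan)
    also have "map (\<lambda>j. x (\<iota> j)) [0..<m] = map (\<lambda>j. x (idx ! j)) [0..<m]"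
      by (rule map_cong) (simp_all add: \<iota>_def)
    finally show ?thesis .
  qed
  also have "(\<Sum>q=1..m. sc (1 / 2 ^ q) * (rising (Suc q) (Suc m) * summand m {..<m} q)) = (\<Sum>q=1..m.
            sc (1 / 2 ^ q) * prod_list (map (\<lambda>k. H + of_nat k) [q+1..<m+1])
            * F ^ (q - 1)
            * (Y * (\<Sum>t=0..q-1. bracket n eta sc x d g t (int m - int q - int t) 1 (q - 1 - t) idx)
              + F * (\<Sum>t=0..q. bracket n eta sc x d g t (int m - int q - int t) 0 (q - t) idx)))"
  proof (intro sum.cong refl)
    fix q assume q: "q \<in> {1..m}"
    then have "(\<Sum>t=0..q-1. bracket n eta sc x d g t (int m - int q - int t) 1 (q - 1 - t) idx) =
        bracket_sum 1 (q - 1) (int m - int q) {..<m}"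
      and "(\<Sum>t=0..q. bracket n eta sc x d g t (int m - int q - int t) 0 (q - t) idx) =
        bracket_sum 0 q (int m - int q) {..<m}"
      by (simp_all only: sums le_add_diff_inverse2 atLeastAtMost_iff add_0_right)
    with q show "sc (1 / 2 ^ q) * (rising (Suc q) (Suc m) * summand m {..<m} q) =
        sc (1 / 2 ^ q) * prod_list (map (\<lambda>k. H + of_nat k) [q+1..<m+1]) * F ^ (q - 1)
            * (Y * (\<Sum>t=0..q-1. bracket n eta sc x d g t (int m - int q - int t) 1 (q - 1 - t) idx)
              + F * (\<Sum>t=0..q. bracket n eta sc x d g t (int m - int q - int t) 0 (q - t) idx))"
      by (simp only: summand_def rising_def mult.assoc atLeastAtMost_iff if_False Suc_eq_plus1) simp
  qed
  finally show ?thesis by (simp add: rising_def)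
qed

end

theorem theorem5p4:
  fixes n m :: nat and eta etal :: "nat \<Rightarrow> nat \<Rightarrow> complex"
    and sc :: "complex \<Rightarrow> 'b::ring_1" and x d g :: "nat \<Rightarrow> 'b" and idx :: "nat list"
  assumes "n \<ge> 1" and "metric n eta etal" and "WC_alg n eta sc x d g"
    and "m \<ge> 1" and "length idx = m" and "\<forall>i\<in>set idx. i < n"
  shows "in_Iprime n eta sc x d g
    (prod_list (map (\<lambda>j. xhat n eta etal sc x d g (idx ! j)) [0..<m])
     - ( prod_list (map (\<lambda>k. Hop n sc x d + of_nat k) [1..<m+1])
           * prod_list (map (\<lambda>j. x (idx ! j)) [0..<m])
       + (\<Sum>q=1..m.
            sc (1 / 2 ^ q) * prod_list (map (\<lambda>k. Hop n sc x d + of_nat k) [q+1..<m+1])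
            * Ftil n etal sc x ^ (q - 1)
            * ( Ytil n etal sc x g
                  * (\<Sum>t=0..q-1. bracket n eta sc x d g t (int m - int q - int t) 1 (q - 1 - t) idx)
              + Ftil n etal sc x
                  * (\<Sum>t=0..q. bracket n eta sc x d g t (int m - int q - int t) 0 (q - t) idx)))))"
proof -
  interpret weyl_clifford n eta etal sc x d g
    by unfold_locales fact+
  \<comment> \<open>The difference is 0 in the ring, and 0 lies in the ideal with both coefficients
    equal to 0.\<close>
  have "0 \<in> Aloc n sc x d g"
    using Aloc.scal[of sc 0] by (simp add: sc_0)
  then have "in_Iprime n eta sc x d g 0"
    unfolding in_Iprime_def by force
  then show ?thesis
    unfolding prod_xhat[OF assms(1,5,6)] by simp
qed

end
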